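(* Every instance of Second-Order SAT is polynomial-time reducible to an instance of the finite synthesis problem, i.e. to deciding the truth of a formula $\exists P .\, \forall x \in \mathcal{D} .\, \sigma(P,x)$.
   Context: Second-Order SAT: decide the truth of a sentence $\exists S_1 \ldots S_m . Q_1 x_1 \ldots Q_n x_n . \sigma$ where each $S_i$ ranges over relations $S_i\subseteq\mathbb{B}^{\mathrm{ar}(S_i)}$, each $Q_j\in\{\exists,\forall\}$, each $x_j$ ranges over Booleans, and $\sigma$ is a quantifier-free propositional formula over the $x_j$ and atoms of the $S_i$. Finite synthesis: a program $P$ is a finite list of instructions in SSA form with no back jumps (loop-free, non-recursive); inputs $x$ are drawn from a finite domain $\mathcal{D}$; the specification $\sigma(P,x)$ is a Boolean-valued function of the program and the input (which may refer to $\mathtt{exec}(P,x)$, the result of running $P$ on input $x$, a total function); the problem asks whether $\exists P . \forall x\in\mathcal{D} . \sigma(P,x)$ holds. *)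

theory Defs
  imports Main "HOL-Computational_Algebra.Polynomial"
begin

section \<open>Deterministic multi-tape Turing machines and polynomial-time reductions\<close>

datatype move = MLeft | MStay | MRight

text \<open>Tapes are infinite in both directions; the tape alphabet is \<open>'s\<close> together with the blank
  \<open>None\<close>. A tape is its contents together with the position of the head.\<close>

type_synonym 's tape = "(int \<Rightarrow> 's option) \<times> int"

text \<open>States are \<open>0, \<dots>, tm_states - 1\<close>, where \<open>0\<close> is initial and \<open>1\<close> is halting. Tape \<open>0\<close>
  is the input tape and tape \<open>1\<close> the output tape.\<close>

record 's tm =
  tm_tapes :: nat
  tm_states :: nat
  tm_delta :: "nat \<Rightarrow> 's option list \<Rightarrow> nat \<times> ('s option \<times> move) list"

definition tm_wf :: "'s tm \<Rightarrow> bool" where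
  "tm_wf M \<longleftrightarrow> 2 \<le> tm_tapes M \<and> 2 \<le> tm_states M \<and>
     (\<forall>q ss. q < tm_states M \<and> length ss = tm_tapes M \<longrightarrow>
        fst (tm_delta M q ss) < tm_states M \<and> length (snd (tm_delta M q ss)) = tm_tapes M)"

type_synonym 's config = "nat \<times> 's tape list"

definition tape_read :: "'s tape \<Rightarrow> 's option" where
  "tape_read t = fst t (snd t)"

definition tape_act :: "'s option \<times> move \<Rightarrow> 's tape \<Rightarrow> 's tape" where
  "tape_act a t =
     ((fst t)(snd t := fst a),
      (case snd a of MLeft \<Rightarrow> snd t - 1 | MStay \<Rightarrow> snd t | MRight \<Rightarrow> snd t + 1))"

definition tm_step :: "'s tm \<Rightarrow> 's config \<Rightarrow> 's config" where
  "tm_step M c =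
     (if fst c = 1 then c
      else let (q, as) = tm_delta M (fst c) (map tape_read (snd c))
           in (q, map2 tape_act as (snd c)))"

definition tape_contents :: "'s list \<Rightarrow> int \<Rightarrow> 's option" where
  "tape_contents w i = (if 0 \<le> i \<and> i < int (length w) then Some (w ! nat i) else None)"

definition tm_init :: "'s tm \<Rightarrow> 's list \<Rightarrow> 's config" where
  "tm_init M w = (0, (tape_contents w, 0) # replicate (tm_tapes M - 1) (tape_contents [], 0))"

text \<open>Halting configurations are fixed points of \<^const>\<open>tm_step\<close>, so this says that the machine
  halts after at most \<open>t\<close> steps with exactly \<open>v\<close> on the output tape.\<close>

definition tm_outputs_within :: "'s tm \<Rightarrow> 's list \<Rightarrow> nat \<Rightarrow> 's list \<Rightarrow> bool" where
  "tm_outputs_within M w t v \<longleftrightarrow>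
     (let c = (tm_step M ^^ t) (tm_init M w)
      in fst c = 1 \<and> fst (snd c ! 1) = tape_contents v)"

record ('i, 's) decision_problem =
  instances :: "'i set"
  encode :: "'i \<Rightarrow> 's list"
  holds :: "'i \<Rightarrow> bool"

text \<open>The class constraint makes the alphabet finite.\<close>

definition poly_time_computable ::
  "('i, 's::finite) decision_problem \<Rightarrow> ('j, 's) decision_problem \<Rightarrow> ('i \<Rightarrow> 'j) \<Rightarrow> bool" where
  "poly_time_computable A B f \<longleftrightarrow>
     (\<exists>(M :: 's tm) (p :: nat poly). tm_wf M \<and>
        (\<forall>x\<in>instances A.
           tm_outputs_within M (encode A x) (poly p (length (encode A x))) (encode B (f x))))"

definition poly_time_reducible ::
  "('i, 's::finite) decision_problem \<Rightarrow> ('j, 's) decision_problem \<Rightarrow> bool" where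
  "poly_time_reducible A B \<longleftrightarrow>
     (\<exists>f. poly_time_computable A B f \<and>
        (\<forall>x\<in>instances A. f x \<in> instances B \<and> (holds A x \<longleftrightarrow> holds B (f x))))"


section \<open>Second-Order SAT\<close>

datatype quantifier = QEx | QAll

text \<open>\<open>FVar j\<close> is the first-order variable bound by the \<open>j\<close>-th quantifier of the prefix and
  \<open>FRel i js\<close> the atom of the \<open>i\<close>-th relation symbol (both counted from \<open>0\<close>).\<close>

datatype form =
    FVar nat
  | FRel nat "nat list"
  | FTrue
  | FFalse
  | FNot form
  | FAnd form form
  | FOr form form
  | FImp form form
  | FIff form form

record so_sentence =
  so_arities :: "nat list"
  so_prefix :: "quantifier list"
  so_matrix :: form

fun form_wf :: "nat list \<Rightarrow> nat \<Rightarrow> form \<Rightarrow> bool" where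
  "form_wf ars n (FVar j) \<longleftrightarrow> j < n"
| "form_wf ars n (FRel i js) \<longleftrightarrow> i < length ars \<and> length js = ars ! i \<and> (\<forall>j\<in>set js. j < n)"
| "form_wf ars n FTrue \<longleftrightarrow> True"
| "form_wf ars n FFalse \<longleftrightarrow> True"
| "form_wf ars n (FNot f) \<longleftrightarrow> form_wf ars n f"
| "form_wf ars n (FAnd f g) \<longleftrightarrow> form_wf ars n f \<and> form_wf ars n g"
| "form_wf ars n (FOr f g) \<longleftrightarrow> form_wf ars n f \<and> form_wf ars n g"
| "form_wf ars n (FImp f g) \<longleftrightarrow> form_wf ars n f \<and> form_wf ars n g"
| "form_wf ars n (FIff f g) \<longleftrightarrow> form_wf ars n f \<and> form_wf ars n g"

definition so_wf :: "so_sentence \<Rightarrow> bool" where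
  "so_wf \<phi> \<longleftrightarrow> form_wf (so_arities \<phi>) (length (so_prefix \<phi>)) (so_matrix \<phi>)"

fun form_eval :: "bool list set list \<Rightarrow> bool list \<Rightarrow> form \<Rightarrow> bool" where
  "form_eval S x (FVar j) \<longleftrightarrow> x ! j"
| "form_eval S x (FRel i js) \<longleftrightarrow> map (\<lambda>j. x ! j) js \<in> S ! i"
| "form_eval S x FTrue \<longleftrightarrow> True"
| "form_eval S x FFalse \<longleftrightarrow> False"
| "form_eval S x (FNot f) \<longleftrightarrow> \<not> form_eval S x f"
| "form_eval S x (FAnd f g) \<longleftrightarrow> form_eval S x f \<and> form_eval S x g"
| "form_eval S x (FOr f g) \<longleftrightarrow> form_eval S x f \<or> form_eval S x g"
| "form_eval S x (FImp f g) \<longleftrightarrow> (form_eval S x f \<longrightarrow> form_eval S x g)"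
| "form_eval S x (FIff f g) \<longleftrightarrow> (form_eval S x f \<longleftrightarrow> form_eval S x g)"

text \<open>The list argument collects the values of the variables already quantified.\<close>

fun prefix_holds :: "quantifier list \<Rightarrow> bool list \<Rightarrow> (bool list \<Rightarrow> bool) \<Rightarrow> bool" where
  "prefix_holds [] x R \<longleftrightarrow> R x"
| "prefix_holds (QEx # qs) x R \<longleftrightarrow> (\<exists>b. prefix_holds qs (x @ [b]) R)"
| "prefix_holds (QAll # qs) x R \<longleftrightarrow> (\<forall>b. prefix_holds qs (x @ [b]) R)"

definition so_true :: "so_sentence \<Rightarrow> bool" where
  "so_true \<phi> \<longleftrightarrow>
     (\<exists>S. list_all2 (\<lambda>R a. R \<subseteq> {bs. length bs = a}) S (so_arities \<phi>) \<and>
        prefix_holds (so_prefix \<phi>) [] (\<lambda>x. form_eval S x (so_matrix \<phi>)))"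


section \<open>Finite synthesis\<close>

text \<open>All operations act on \<open>w\<close>-bit words, represented by the natural numbers below \<open>2 ^ w\<close>.
  As usual a word counts as true iff it is nonzero, and comparisons return \<open>0\<close> or \<open>1\<close>.\<close>

datatype unop = ONeg | ONot

datatype binop =
  OAdd | OSub | OMul | ODiv | OMod | OAnd | OOr | OXor | OShl | OShr | OEq | OLe | OLt

fun unop_eval :: "nat \<Rightarrow> unop \<Rightarrow> nat \<Rightarrow> nat" where
  "unop_eval w ONeg a = take_bit w (2 ^ w - a)"
| "unop_eval w ONot a = take_bit w (2 ^ w - 1 - a)"

fun binop_eval :: "nat \<Rightarrow> binop \<Rightarrow> nat \<Rightarrow> nat \<Rightarrow> nat" where
  "binop_eval w OAdd a b = take_bit w (a + b)"
| "binop_eval w OSub a b = take_bit w (2 ^ w + a - b)"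
| "binop_eval w OMul a b = take_bit w (a * b)"
| "binop_eval w ODiv a b = take_bit w (a div b)"
| "binop_eval w OMod a b = take_bit w (a mod b)"
| "binop_eval w OAnd a b = take_bit w (and a b)"
| "binop_eval w OOr a b = take_bit w (or a b)"
| "binop_eval w OXor a b = take_bit w (xor a b)"
| "binop_eval w OShl a b = take_bit w (push_bit b a)"
| "binop_eval w OShr a b = take_bit w (drop_bit b a)"
| "binop_eval w OEq a b = take_bit w (of_bool (a = b))"
| "binop_eval w OLe a b = take_bit w (of_bool (a \<le> b))"
| "binop_eval w OLt a b = take_bit w (of_bool (a < b))"

text \<open>The \<open>k\<close>-th instruction of a program is the only one that assigns register \<open>k\<close>, which makes
  programs SSA by construction. \<open>IJump a d\<close> skips the next \<open>d\<close> instructions if \<open>a\<close> is nonzero;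
  as \<open>d\<close> is a natural number there are no back jumps. Registers of jumps and of skipped
  instructions are \<open>0\<close>. Values are merged after a branch with \<open>IIte\<close>.\<close>

datatype operand = Inp nat | Reg nat | Imm nat

datatype instr =
    IUn unop operand
  | IBin binop operand operand
  | IIte operand operand operand
  | IJump operand nat

type_synonym program = "instr list"

text \<open>Below, \<open>w\<close> is the word width, \<open>n\<close> the number of inputs, \<open>l\<close> the length of the program and
  \<open>k\<close> the position of the instruction.\<close>

fun operand_wf :: "nat \<Rightarrow> nat \<Rightarrow> nat \<Rightarrow> operand \<Rightarrow> bool" where
  "operand_wf w n k (Inp j) \<longleftrightarrow> j < n"
| "operand_wf w n k (Reg i) \<longleftrightarrow> i < k"
| "operand_wf w n k (Imm c) \<longleftrightarrow> c < 2 ^ w"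

fun instr_wf :: "nat \<Rightarrow> nat \<Rightarrow> nat \<Rightarrow> nat \<Rightarrow> instr \<Rightarrow> bool" where
  "instr_wf w n l k (IUn f a) \<longleftrightarrow> operand_wf w n k a"
| "instr_wf w n l k (IBin f a b) \<longleftrightarrow> operand_wf w n k a \<and> operand_wf w n k b"
| "instr_wf w n l k (IIte a b c) \<longleftrightarrow>
     operand_wf w n k a \<and> operand_wf w n k b \<and> operand_wf w n k c"
| "instr_wf w n l k (IJump a d) \<longleftrightarrow> operand_wf w n k a \<and> k + 1 + d \<le> l"

definition programs :: "nat \<Rightarrow> nat \<Rightarrow> program set" where
  "programs w n = {P. \<forall>k<length P. instr_wf w n (length P) k (P ! k)}"

fun operand_eval :: "nat list \<Rightarrow> nat list \<Rightarrow> operand \<Rightarrow> nat" where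
  "operand_eval x regs (Inp j) = x ! j"
| "operand_eval x regs (Reg i) = regs ! i"
| "operand_eval x regs (Imm c) = c"

fun instr_eval :: "nat \<Rightarrow> nat list \<Rightarrow> nat list \<Rightarrow> instr \<Rightarrow> nat" where
  "instr_eval w x regs (IUn f a) = unop_eval w f (operand_eval x regs a)"
| "instr_eval w x regs (IBin f a b) =
     binop_eval w f (operand_eval x regs a) (operand_eval x regs b)"
| "instr_eval w x regs (IIte a b c) =
     (if operand_eval x regs a \<noteq> 0 then operand_eval x regs b else operand_eval x regs c)"
| "instr_eval w x regs (IJump a d) = 0"

fun instr_skip :: "nat list \<Rightarrow> nat list \<Rightarrow> instr \<Rightarrow> nat" where
  "instr_skip x regs (IJump a d) = (if operand_eval x regs a \<noteq> 0 then d else 0)"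
| "instr_skip x regs _ = 0"

text \<open>\<open>run w x s regs P\<close> continues with the remaining instructions \<open>P\<close>, the first \<open>s\<close> of which are
  to be skipped, after the earlier ones have produced the register contents \<open>regs\<close>.\<close>

fun run :: "nat \<Rightarrow> nat list \<Rightarrow> nat \<Rightarrow> nat list \<Rightarrow> program \<Rightarrow> nat list" where
  "run w x s regs [] = regs"
| "run w x (Suc s) regs (i # P) = run w x s (regs @ [0]) P"
| "run w x 0 regs (i # P) =
     run w x (instr_skip x regs i) (regs @ [instr_eval w x regs i]) P"

text \<open>The result is the register of the last instruction; the leading \<open>0\<close> serves the empty
  program.\<close>

definition exec :: "nat \<Rightarrow> program \<Rightarrow> nat list \<Rightarrow> nat" where
  "exec w P x = last (0 # run w x 0 [] P)"

definition finite_synthesis ::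
  "program set \<Rightarrow> nat list set \<Rightarrow> (program \<Rightarrow> nat list \<Rightarrow> bool) \<Rightarrow> bool" where
  "finite_synthesis Ps D \<sigma> \<longleftrightarrow> (\<exists>P\<in>Ps. \<forall>x\<in>D. \<sigma> P x)"

text \<open>Specifications are expressions over the input that may run the program on arbitrary inputs,
  in particular on the given one.\<close>

datatype spec =
    SInp nat
  | SConst nat
  | SUn unop spec
  | SBin binop spec spec
  | SIte spec spec spec
  | SExec "spec list"

fun spec_wf :: "nat \<Rightarrow> nat \<Rightarrow> spec \<Rightarrow> bool" where
  "spec_wf w n (SInp j) \<longleftrightarrow> j < n"
| "spec_wf w n (SConst c) \<longleftrightarrow> c < 2 ^ w"
| "spec_wf w n (SUn f s) \<longleftrightarrow> spec_wf w n s"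
| "spec_wf w n (SBin f s t) \<longleftrightarrow> spec_wf w n s \<and> spec_wf w n t"
| "spec_wf w n (SIte r s t) \<longleftrightarrow> spec_wf w n r \<and> spec_wf w n s \<and> spec_wf w n t"
| "spec_wf w n (SExec ss) \<longleftrightarrow> length ss = n \<and> (\<forall>s\<in>set ss. spec_wf w n s)"

fun spec_eval :: "nat \<Rightarrow> program \<Rightarrow> nat list \<Rightarrow> spec \<Rightarrow> nat" where
  "spec_eval w P x (SInp j) = x ! j"
| "spec_eval w P x (SConst c) = c"
| "spec_eval w P x (SUn f s) = unop_eval w f (spec_eval w P x s)"
| "spec_eval w P x (SBin f s t) = binop_eval w f (spec_eval w P x s) (spec_eval w P x t)"
| "spec_eval w P x (SIte r s t) =
     (if spec_eval w P x r \<noteq> 0 then spec_eval w P x s else spec_eval w P x t)"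
| "spec_eval w P x (SExec ss) = exec w P (map (spec_eval w P x) ss)"

text \<open>The finite domain consists of all \<open>n\<close>-tuples of \<open>w\<close>-bit words.\<close>

record synthesis_instance =
  fs_width :: nat
  fs_inputs :: nat
  fs_spec :: spec

definition fs_wf :: "synthesis_instance \<Rightarrow> bool" where
  "fs_wf \<psi> \<longleftrightarrow> 0 < fs_width \<psi> \<and> spec_wf (fs_width \<psi>) (fs_inputs \<psi>) (fs_spec \<psi>)"

definition fs_domain :: "synthesis_instance \<Rightarrow> nat list set" where
  "fs_domain \<psi> = {x. length x = fs_inputs \<psi> \<and> (\<forall>a\<in>set x. a < 2 ^ fs_width \<psi>)}"

lemma finite_fs_domain: "finite (fs_domain \<psi>)"
proof -
  have "fs_domain \<psi> = {x. set x \<subseteq> {..<2 ^ fs_width \<psi>} \<and> length x = fs_inputs \<psi>}"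
    by (auto simp: fs_domain_def)
  then show ?thesis by (simp add: finite_lists_length_eq)
qed

definition fs_true :: "synthesis_instance \<Rightarrow> bool" where
  "fs_true \<psi> \<longleftrightarrow>
     finite_synthesis (programs (fs_width \<psi>) (fs_inputs \<psi>)) (fs_domain \<psi>)
       (\<lambda>P x. spec_eval (fs_width \<psi>) P x (fs_spec \<psi>) \<noteq> 0)"


section \<open>Encodings of instances as strings\<close>

datatype token =
    TTick | TEnd | TBit bool | TDecl | TQuant quantifier | TVar | TRel
  | TTrue | TFalse | TNot | TAnd | TOr | TImp | TIff
  | TConst | TUn unop | TBin binop | TIte | TExec

instance quantifier :: finite
proof
  have "UNIV = {QEx, QAll}" using quantifier.exhaust by auto
  then show "finite (UNIV :: quantifier set)" by (metis finite.simps)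
qed

instance unop :: finite
proof
  have "UNIV = {ONeg, ONot}" using unop.exhaust by auto
  then show "finite (UNIV :: unop set)" by (metis finite.simps)
qed

instance binop :: finite
proof
  have "x \<in> set [OAdd, OSub, OMul, ODiv, OMod, OAnd, OOr, OXor, OShl, OShr, OEq, OLe, OLt]" for x
    by (cases x) simp_all
  then show "finite (UNIV :: binop set)" by (metis finite_set finite_subset subsetI)
qed

instance token :: finite
proof
  have "x \<in> set [TTick, TEnd, TDecl, TVar, TRel, TTrue, TFalse, TNot, TAnd, TOr, TImp, TIff,
      TConst, TIte, TExec] \<union> range TBit \<union> range TQuant \<union> range TUn \<union> range TBin" for x
    by (cases x) simp_all
  then have "UNIV \<subseteq> set [TTick, TEnd, TDecl, TVar, TRel, TTrue, TFalse, TNot, TAnd, TOr, TImp, TIff,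
      TConst, TIte, TExec] \<union> range TBit \<union> range TQuant \<union> range TUn \<union> range TBin" by blast
  then show "finite (UNIV :: token set)"
    by (rule finite_subset) (intro finite_UnI finite_set finite_imageI finite)
qed

text \<open>Indices, arities, the word width and the number of inputs are written in unary, constants in
  binary (least significant bit first), and expressions in prefix notation.\<close>

definition enc_unary :: "nat \<Rightarrow> token list" where
  "enc_unary k = replicate k TTick @ [TEnd]"

fun enc_bits :: "nat \<Rightarrow> token list" where
  "enc_bits c = (if c = 0 then [] else TBit (odd c) # enc_bits (c div 2))"

declare enc_bits.simps [simp del]

definition enc_var :: "nat \<Rightarrow> token list" where
  "enc_var j = TVar # enc_unary j"

fun enc_form :: "form \<Rightarrow> token list" where
  "enc_form (FVar j) = enc_var j"
| "enc_form (FRel i js) = TRel # enc_unary i @ concat (map enc_var js) @ [TEnd]"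
| "enc_form FTrue = [TTrue]"
| "enc_form FFalse = [TFalse]"
| "enc_form (FNot f) = TNot # enc_form f"
| "enc_form (FAnd f g) = TAnd # enc_form f @ enc_form g"
| "enc_form (FOr f g) = TOr # enc_form f @ enc_form g"
| "enc_form (FImp f g) = TImp # enc_form f @ enc_form g"
| "enc_form (FIff f g) = TIff # enc_form f @ enc_form g"

definition enc_so :: "so_sentence \<Rightarrow> token list" where
  "enc_so \<phi> = concat (map (\<lambda>a. TDecl # enc_unary a) (so_arities \<phi>)) @
     map TQuant (so_prefix \<phi>) @ enc_form (so_matrix \<phi>)"

fun enc_spec :: "spec \<Rightarrow> token list" where
  "enc_spec (SInp j) = enc_var j"
| "enc_spec (SConst c) = TConst # enc_bits c @ [TEnd]"
| "enc_spec (SUn f s) = TUn f # enc_spec s"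
| "enc_spec (SBin f s t) = TBin f # enc_spec s @ enc_spec t"
| "enc_spec (SIte r s t) = TIte # enc_spec r @ enc_spec s @ enc_spec t"
| "enc_spec (SExec ss) = TExec # concat (map enc_spec ss) @ [TEnd]"

definition enc_fs :: "synthesis_instance \<Rightarrow> token list" where
  "enc_fs \<psi> = enc_unary (fs_width \<psi>) @ enc_unary (fs_inputs \<psi>) @ enc_spec (fs_spec \<psi>)"

definition SO_SAT :: "(so_sentence, token) decision_problem" where
  "SO_SAT = \<lparr>instances = {\<phi>. so_wf \<phi>}, encode = enc_so, holds = so_true\<rparr>"

definition Finite_Synthesis :: "(synthesis_instance, token) decision_problem" where
  "Finite_Synthesis = \<lparr>instances = {\<psi>. fs_wf \<psi>}, encode = enc_fs, holds = fs_true\<rparr>"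


subsection \<open>The encodings are injective\<close>

lemma enc_unary_append_eq:
  "enc_unary k @ r = enc_unary k' @ r' \<longleftrightarrow> k = k' \<and> r = r'"
proof (induction k arbitrary: k')
  case 0
  then show ?case by (cases k') (auto simp: enc_unary_def)
next
  case (Suc k)
  then show ?case by (cases k') (auto simp: enc_unary_def)
qed

lemma enc_bits_append_eq:
  "enc_bits c @ TEnd # r = enc_bits c' @ TEnd # r' \<Longrightarrow> c = c' \<and> r = r'"
proof (induction c arbitrary: c' rule: less_induct)
  case (less c)
  show ?case
  proof (cases "c = 0 \<or> c' = 0")
    case True
    then show ?thesis using less.prems
      by (auto simp: enc_bits.simps[of c] enc_bits.simps[of c'] enc_bits.simps[of 0] split: if_splits)
  next
    case False
    then have *: "odd c = odd c'" "enc_bits (c div 2) @ TEnd # r = enc_bits (c' div 2) @ TEnd # r'"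
      using less.prems by (simp_all add: enc_bits.simps[of c] enc_bits.simps[of c'])
    moreover have "c div 2 < c" using False by simp
    ultimately have "c div 2 = c' div 2" "r = r'" using less.IH by blast+
    with *(1) show ?thesis by (metis bit_eq_rec even_iff_mod_2_eq_zero odd_two_times_div_two_succ
          dvd_mult_div_cancel)
  qed
qed

lemma enc_vars_append_eq:
  "concat (map enc_var js) @ TEnd # r = concat (map enc_var js') @ TEnd # r' \<Longrightarrow> js = js' \<and> r = r'"
proof (induction js arbitrary: js')
  case Nil
  then show ?case by (cases js') (auto simp: enc_var_def)
next
  case (Cons j js)
  then show ?case by (cases js') (auto simp: enc_var_def enc_unary_append_eq)
qed

lemma enc_form_append_eq: "enc_form f @ r = enc_form f' @ r' \<Longrightarrow> f = f' \<and> r = r'"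
proof (induction f arbitrary: f' r r')
  case (FVar j)
  then show ?case by (cases f') (auto simp: enc_var_def enc_unary_append_eq)
next
  case (FRel i js)
  then show ?case
    by (cases f') (auto simp: enc_var_def enc_unary_append_eq dest: enc_vars_append_eq)
next
  case FTrue
  then show ?case by (cases f') (auto simp: enc_var_def)
next
  case FFalse
  then show ?case by (cases f') (auto simp: enc_var_def)
next
  case (FNot f)
  from FNot.prems show ?case by (cases f') (auto simp: enc_var_def dest: FNot.IH)
next
  case (FAnd f g)
  from FAnd.prems show ?case by (cases f') (auto simp: enc_var_def dest!: FAnd.IH)
next
  case (FOr f g)
  from FOr.prems show ?case by (cases f') (auto simp: enc_var_def dest!: FOr.IH)
next
  case (FImp f g)
  from FImp.prems show ?case by (cases f') (auto simp: enc_var_def dest!: FImp.IH)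
next
  case (FIff f g)
  from FIff.prems show ?case by (cases f') (auto simp: enc_var_def dest!: FIff.IH)
qed

lemma enc_spec_neq_TEnd: "enc_spec s @ r' \<noteq> TEnd # r"
  by (cases s) (simp_all add: enc_var_def)

lemma enc_specs_append_eq:
  assumes "\<And>s s' r r'. s \<in> set ss \<Longrightarrow> enc_spec s @ r = enc_spec s' @ r' \<Longrightarrow> s = s' \<and> r = r'"
    and "concat (map enc_spec ss) @ TEnd # r = concat (map enc_spec ss') @ TEnd # r'"
  shows "ss = ss' \<and> r = r'"
  using assms
proof (induction ss arbitrary: ss')
  case Nil
  then show ?case
    by (cases ss') (auto simp: enc_spec_neq_TEnd[symmetric])
next
  case (Cons s ss)
  show ?case
  proof (cases ss')
    case Nil
    with Cons.prems(2) show ?thesis by (simp add: enc_spec_neq_TEnd)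
  next
    case (Cons s' ts)
    with Cons.prems(2)
    have "enc_spec s @ (concat (map enc_spec ss) @ TEnd # r) =
        enc_spec s' @ (concat (map enc_spec ts) @ TEnd # r')" by simp
    then have "s = s' \<and> concat (map enc_spec ss) @ TEnd # r = concat (map enc_spec ts) @ TEnd # r'"
      by (rule Cons.prems(1)[rotated]) simp
    with Cons.IH[of ts] Cons.prems(1) Cons show ?thesis by (metis list.set_intros(2))
  qed
qed

lemma enc_spec_append_eq: "enc_spec s @ r = enc_spec s' @ r' \<Longrightarrow> s = s' \<and> r = r'"
proof (induction s arbitrary: s' r r')
  case (SInp j)
  then show ?case by (cases s') (auto simp: enc_var_def enc_unary_append_eq)
next
  case (SConst c)
  then show ?case by (cases s') (auto simp: enc_var_def dest: enc_bits_append_eq)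
next
  case (SUn f s)
  from SUn.prems show ?case by (cases s') (auto simp: enc_var_def dest: SUn.IH)
next
  case (SBin f s t)
  from SBin.prems show ?case by (cases s') (auto simp: enc_var_def dest!: SBin.IH)
next
  case (SIte q s t)
  from SIte.prems show ?case by (cases s') (auto simp: enc_var_def dest!: SIte.IH)
next
  case (SExec ss)
  show ?case
  proof (cases s')
    case (SExec ss')
    with SExec.prems have "concat (map enc_spec ss) @ TEnd # r = concat (map enc_spec ss') @ TEnd # r'"
      by simp
    from enc_specs_append_eq[OF SExec.IH this] SExec show ?thesis by simp
  qed (use SExec.prems in \<open>simp_all add: enc_var_def\<close>)
qed

lemma enc_form_neq: "enc_form f @ r \<noteq> TDecl # r'" "enc_form f @ r \<noteq> TQuant q # r'"
  by (cases f; simp add: enc_var_def)+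

lemma enc_prefix_append_eq:
  "map TQuant qs @ enc_form f = map TQuant qs' @ enc_form f' \<Longrightarrow> qs = qs' \<and> f = f'"
proof (induction qs arbitrary: qs')
  case Nil
  then show ?case
    using enc_form_append_eq[of f "[]" f' "[]"] enc_form_neq(2)[of f "[]"] by (cases qs') auto
next
  case (Cons q qs)
  then show ?case using enc_form_neq(2)[of f' "[]"] by (cases qs') (auto dest: sym)
qed

lemma enc_matrix_neq: "map TQuant qs @ enc_form f \<noteq> TDecl # r"
  using enc_form_neq(1)[of f "[]"] by (cases qs) auto

lemma enc_decls_append_eq:
  "concat (map (\<lambda>a. TDecl # enc_unary a) as) @ map TQuant qs @ enc_form f =
   concat (map (\<lambda>a. TDecl # enc_unary a) as') @ map TQuant qs' @ enc_form f' \<Longrightarrow>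
   as = as' \<and> qs = qs' \<and> f = f'"
proof (induction as arbitrary: as')
  case Nil
  then show ?case
    by (cases as') (auto simp: enc_matrix_neq dest: enc_prefix_append_eq)
next
  case (Cons a as)
  then show ?case
    using enc_matrix_neq[of qs' f']
    by (cases as') (auto simp: enc_unary_append_eq dest: sym)
qed

lemma inj_enc_so: "inj enc_so"
  by (rule injI) (auto simp: enc_so_def dest!: enc_decls_append_eq)

lemma inj_enc_fs: "inj enc_fs"
proof (rule injI)
  fix \<psi> \<psi>' :: synthesis_instance
  assume "enc_fs \<psi> = enc_fs \<psi>'"
  then show "\<psi> = \<psi>'"
    using enc_spec_append_eq[of "fs_spec \<psi>" "[]" "fs_spec \<psi>'" "[]"]
    by (auto simp: enc_fs_def enc_unary_append_eq)
qed

end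

theory Submission
  imports Defs
begin

text \<open>One synthesised program stands for all relations and for a strategy of the existential
  player: on input \<open>[1, 0, rel_word i bs]\<close> it decides whether \<open>bs\<close> belongs to the \<open>i\<close>-th relation,
  and on \<open>[0, 0, u]\<close>, where \<open>u\<close> holds the values of the universal variables, it returns the values
  of the existential ones. An assignment to all variables is one word \<open>x\<close>, and \<open>e\<close> is the mask of
  the existential positions. The specification says that every \<open>x\<close> that agrees with the strategy
  satisfies the matrix, and that the lowest bit in which two such words differ is never existential,
  so that each existential choice depends on earlier variables only. As \<open>e\<close> is a third universally
  quantified input, constrained by one equation, the mask is written only once. No part of the
  specification needs a counter: after a first pass that writes the word width in unary (the length
  of the sentence plus two), it is produced by a finite-state transducer reading the sentence from
  left to right. Relations and strategies can be put into a program because any function on words is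
  computed by a straight-line lookup table, whose size does not matter.\<close>

section \<open>Turing machines simulating finite-state transducers\<close>

type_synonym 's transducer = "nat \<Rightarrow> 's option \<Rightarrow> nat \<times> move \<times> 's list"

definition move_pos :: "move \<Rightarrow> int \<Rightarrow> int" where
  "move_pos mv i = (case mv of MLeft \<Rightarrow> i - 1 | MStay \<Rightarrow> i | MRight \<Rightarrow> i + 1)"

fun transducer_step :: "'s transducer \<Rightarrow> 's list \<Rightarrow> nat \<times> int \<times> 's list \<Rightarrow> nat \<times> int \<times> 's list" where
  "transducer_step \<delta> w (q, i, out) =
     (let (q', mv, u) = \<delta> q (tape_contents w i) in (q', move_pos mv i, out @ u))"

definition transducer_wf :: "nat \<Rightarrow> nat \<Rightarrow> 's transducer \<Rightarrow> bool" where
  "transducer_wf Q K \<delta> \<longleftrightarrow> 2 \<le> Q \<and> (\<forall>s. \<delta> 1 s = (1, MStay, [])) \<and>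
     (\<forall>q<Q. \<forall>s. fst (\<delta> q s) < Q \<and> length (snd (snd (\<delta> q s))) \<le> K)"

text \<open>State \<open>q + Q * k\<close> means that \<open>k\<close> symbols of the current output word of mode \<open>q\<close> have been
  written; the input head does not move meanwhile, so the word need not be stored.\<close>

definition transducer_tm :: "nat \<Rightarrow> nat \<Rightarrow> 's transducer \<Rightarrow> 's tm" where
  "transducer_tm Q K \<delta> =
     \<lparr>tm_tapes = 2, tm_states = Q * (K + 1),
      tm_delta = \<lambda>st ss.
        (let q = st mod Q; k = st div Q; (q', mv, u) = \<delta> q (ss ! 0)
         in if k < length u then (q + Q * (k + 1), [(ss ! 0, MStay), (Some (u ! k), MRight)])
            else (q', [(ss ! 0, mv), (ss ! 1, MStay)]))\<rparr>"

definition transducer_config :: "'s list \<Rightarrow> nat \<Rightarrow> int \<Rightarrow> 's list \<Rightarrow> 's config" where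
  "transducer_config w st i out =
     (st, [(tape_contents w, i), (tape_contents out, int (length out))])"

lemma tm_wf_transducer_tm:
  assumes "transducer_wf Q K \<delta>"
  shows "tm_wf (transducer_tm Q K \<delta>)"
proof -
  have Q: "2 \<le> Q" using assms by (simp add: transducer_wf_def)
  have word: "q + Q * Suc k < Q * Suc K" if "q < Q" "k < K" for q k
  proof -
    have "q + Q * Suc k < Q * Suc (Suc k)" using that by simp
    also have "\<dots> \<le> Q * Suc K" using that by (intro mult_le_mono2) simp
    finally show ?thesis .
  qed
  have pos: "q < Q * Suc K" if "q < Q" for q using that by (simp add: trans_less_add1)
  have two: "2 \<le> Q * Suc K" using Q by (simp add: trans_le_add1)
  have "fst (tm_delta (transducer_tm Q K \<delta>) st ss) < Q * Suc K \<and>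
      length (snd (tm_delta (transducer_tm Q K \<delta>) st ss)) = 2" for st ss
  proof -
    obtain q' mv u where \<delta>: "\<delta> (st mod Q) (ss ! 0) = (q', mv, u)" by (metis prod_cases3)
    have "st mod Q < Q" using Q by simp
    then have "q' < Q" "length u \<le> K"
      using assms \<delta> unfolding transducer_wf_def by (metis fst_conv, metis snd_conv)
    then show ?thesis using pos word[of "st mod Q" "st div Q"] \<open>st mod Q < Q\<close> \<delta>
      by (simp add: transducer_tm_def Let_def)
  qed
  then show ?thesis using two by (simp add: tm_wf_def) (simp add: transducer_tm_def)
qed

lemma tape_contents_snoc:
  "(tape_contents out)(int (length out) := Some a) = tape_contents (out @ [a])"
  by (rule ext) (auto simp: tape_contents_def nth_append)

lemma transducer_tm_step:
  assumes wf: "transducer_wf Q K \<delta>" and q: "q < Q" "q \<noteq> 1" and \<delta>: "\<delta> q (tape_contents w i) = (q', mv, u)"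
  shows "tm_step (transducer_tm Q K \<delta>) (transducer_config w (q + Q * k) i out) =
    (if k < length u then transducer_config w (q + Q * (k + 1)) i (out @ [u ! k])
     else transducer_config w q' (move_pos mv i) out)"
proof -
  have Q: "2 \<le> Q" using wf by (simp add: transducer_wf_def)
  have m: "(q + Q * k) mod Q = q" "(q + Q * k) div Q = k" using q by auto
  \<comment> \<open>The machine halts in state 1 only. Since \<open>Q\<close> is at least 2,
    \<open>q + Q * k\<close> could be 1 only for \<open>q = 1\<close>, which is excluded, so a
    genuine step is taken.\<close>
  have "q + Q * k \<noteq> 1"
  proof
    assume "q + Q * k = 1"
    then have "1 mod Q = q" using m by simp
    then show False using Q q by simp
  qed
  then show ?thesis using m \<delta>
    by (auto simp: tm_step_def transducer_config_def transducer_tm_def tape_read_def tape_act_def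
        Let_def tape_contents_snoc move_pos_def split: move.splits)
qed

lemma transducer_tm_emit:
  assumes wf: "transducer_wf Q K \<delta>" and q: "q < Q" "q \<noteq> 1" and \<delta>: "\<delta> q (tape_contents w i) = (q', mv, u)"
    and "k \<le> length u"
  shows "(tm_step (transducer_tm Q K \<delta>) ^^ k) (transducer_config w q i out) =
    transducer_config w (q + Q * k) i (out @ take k u)"
  using \<open>k \<le> length u\<close>
proof (induction k)
  case (Suc k)
  then show ?case using transducer_tm_step[OF assms(1-4)]
    by (simp add: take_Suc_conv_app_nth)
qed simp

text \<open>The machine needs one step per output symbol and one more to move the input head and
  change the mode. In the halting mode zero steps suffice, because the transducer stands still as
  well.\<close>

lemma transducer_tm_simulates_step:
  assumes wf: "transducer_wf Q K \<delta>" and q: "q < Q"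
    and s: "transducer_step \<delta> w (q, i, out) = (q', i', out')"
  shows "\<exists>t\<le>K + 1. (tm_step (transducer_tm Q K \<delta>) ^^ t) (transducer_config w q i out) =
    transducer_config w q' i' out'"
proof (cases "q = 1")
  case True
  then have "q' = q" "i' = i" "out' = out"
    using s wf by (auto simp: transducer_wf_def move_pos_def)
  then show ?thesis by (intro exI[of _ 0]) simp
next
  case False
  obtain p mv u where \<delta>: "\<delta> q (tape_contents w i) = (p, mv, u)" by (metis prod_cases3)
  have "length u \<le> K" using wf q \<delta> unfolding transducer_wf_def by (metis snd_conv)
  moreover have "(tm_step (transducer_tm Q K \<delta>) ^^ Suc (length u)) (transducer_config w q i out) =
      transducer_config w q' i' out'"
    using transducer_tm_emit[OF wf q False \<delta>, of "length u" out]
      transducer_tm_step[OF wf q False \<delta>, of "length u" "out @ u"] s \<delta> by simp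
  ultimately show ?thesis by (metis Suc_eq_plus1 Suc_le_mono)
qed

lemma transducer_tm_simulates:
  assumes wf: "transducer_wf Q K \<delta>" and q: "q < Q"
    and "(transducer_step \<delta> w ^^ n) (q, i, out) = (q', i', out')"
  shows "q' < Q \<and> (\<exists>t\<le>n * (K + 1). (tm_step (transducer_tm Q K \<delta>) ^^ t) (transducer_config w q i out) =
    transducer_config w q' i' out')"
  using assms(3)
proof (induction n arbitrary: q' i' out')
  case 0
  then show ?case using q by auto
next
  case (Suc n)
  obtain p j v where pjv: "(transducer_step \<delta> w ^^ n) (q, i, out) = (p, j, v)" by (metis prod_cases3)
  from Suc.IH[OF this] obtain t where p: "p < Q" and t: "t \<le> n * (K + 1)"
    "(tm_step (transducer_tm Q K \<delta>) ^^ t) (transducer_config w q i out) = transducer_config w p j v"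
    by blast
  have s: "transducer_step \<delta> w (p, j, v) = (q', i', out')" using Suc.prems pjv by simp
  from transducer_tm_simulates_step[OF wf p s] obtain t' where t': "t' \<le> K + 1"
    "(tm_step (transducer_tm Q K \<delta>) ^^ t') (transducer_config w p j v) = transducer_config w q' i' out'"
    by blast
  have "(tm_step (transducer_tm Q K \<delta>) ^^ (t' + t)) (transducer_config w q i out) =
      transducer_config w q' i' out'" using t t' by (simp add: funpow_add)
  moreover have "t' + t \<le> Suc n * (K + 1)" using t t' by simp
  moreover have "q' < Q" using s p wf
    by (auto simp: transducer_wf_def Let_def split: prod.splits) (metis fst_conv)
  ultimately show ?case by blast
qed

lemma tm_step_halted: "fst c = 1 \<Longrightarrow> (tm_step M ^^ n) c = c"
  by (induction n) (auto simp: tm_step_def)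

text \<open>The simulation may reach the halting state early; the remaining steps up to
  \<open>t\<close> leave the halted configuration fixed.\<close>

lemma transducer_tm_outputs:
  assumes wf: "transducer_wf Q K \<delta>"
    and "(transducer_step \<delta> w ^^ n) (0, 0, []) = (1, i, v)" and "n * (K + 1) \<le> t"
  shows "tm_outputs_within (transducer_tm Q K \<delta>) w t v"
proof -
  let ?M = "transducer_tm Q K \<delta>"
  have "0 < Q" using wf by (simp add: transducer_wf_def)
  from transducer_tm_simulates[OF wf this assms(2)] obtain t' where t': "t' \<le> n * (K + 1)"
    "(tm_step ?M ^^ t') (transducer_config w 0 0 []) = transducer_config w 1 i v" by blast
  have init: "tm_init ?M w = transducer_config w 0 0 []"
    by (simp add: tm_init_def transducer_config_def transducer_tm_def)
  obtain r where r: "t = r + t'" using t' assms(3) by (metis le_add_diff_inverse2 le_trans)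
  have "(tm_step ?M ^^ t) (tm_init ?M w) = transducer_config w 1 i v"
    using tm_step_halted[of "transducer_config w 1 i v"] t'
    by (simp add: init r funpow_add) (simp add: transducer_config_def)
  then show ?thesis by (simp add: tm_outputs_within_def transducer_config_def)
qed

section \<open>Composing left-to-right passes over segments of the input\<close>

text \<open>Quantifying over the surrounding input and the earlier output makes the relation
  compositional, so that the transducer can be verified along the grammar of sentences.\<close>

definition transduces :: "'s transducer \<Rightarrow> nat \<Rightarrow> 's list \<Rightarrow> nat \<Rightarrow> 's list \<Rightarrow> bool" where
  "transduces \<delta> q ts q' u \<longleftrightarrow> (\<forall>pre post out.
     (transducer_step \<delta> (pre @ ts @ post) ^^ length ts) (q, int (length pre), out) =
     (q', int (length pre + length ts), out @ u))"

lemma transducesD: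
  "transduces \<delta> q ts q' u \<Longrightarrow>
   (transducer_step \<delta> (pre @ ts @ post) ^^ length ts) (q, int (length pre), out) =
   (q', int (length pre + length ts), out @ u)"
  by (simp add: transduces_def)

lemma tape_contents_middle: "tape_contents (pre @ t # post) (int (length pre)) = Some t"
  by (simp add: tape_contents_def)

lemma transduces_Nil: "transduces \<delta> q [] q []"
  by (simp add: transduces_def)

lemma transduces_single: "\<delta> q (Some t) = (q', MRight, u) \<Longrightarrow> transduces \<delta> q [t] q' u"
  by (simp add: transduces_def tape_contents_middle move_pos_def)

lemma transduces_append:
  assumes "transduces \<delta> q ts p u" "transduces \<delta> p ts' q' u'"
  shows "transduces \<delta> q (ts @ ts') q' (u @ u')"
  unfolding transduces_def
proof (intro allI)
  fix pre post out
  have 1: "(transducer_step \<delta> (pre @ ts @ ts' @ post) ^^ length ts) (q, int (length pre), out) =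
     (p, int (length pre + length ts), out @ u)"
    using assms(1) unfolding transduces_def by blast
  have "(transducer_step \<delta> ((pre @ ts) @ ts' @ post) ^^ length ts') (p, int (length (pre @ ts)), out @ u) =
     (q', int (length (pre @ ts) + length ts'), (out @ u) @ u')"
    using assms(2) unfolding transduces_def by blast
  with 1 show "(transducer_step \<delta> (pre @ (ts @ ts') @ post) ^^ length (ts @ ts'))
     (q, int (length pre), out) = (q', int (length pre + length (ts @ ts')), out @ u @ u')"
    by (simp add: funpow_add add.commute[of "length ts"] add.assoc)
qed

lemma transduces_Cons:
  "\<delta> q (Some t) = (p, MRight, u) \<Longrightarrow> transduces \<delta> p ts q' u' \<Longrightarrow> transduces \<delta> q (t # ts) q' (u @ u')"
  using transduces_append[OF transduces_single, of \<delta> q t p u ts q' u'] by simp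

lemma transduces_map_loop:
  assumes "\<And>t. t \<in> set ts \<Longrightarrow> \<delta> q (Some t) = (q, MRight, g t)"
  shows "transduces \<delta> q ts q (concat (map g ts))"
  using assms by (induction ts) (auto intro: transduces_Nil transduces_Cons)

section \<open>Programs as lookup tables\<close>

lemma take_bit_of_bool: "0 < w \<Longrightarrow> take_bit w (of_bool b :: nat) = of_bool b"
  by (cases w) (auto simp: take_bit_Suc)

definition straight_line :: "program \<Rightarrow> bool" where
  "straight_line P \<longleftrightarrow> (\<forall>i\<in>set P. \<forall>a d. i \<noteq> IJump a d)"

lemma instr_skip_straight: "(\<forall>a d. i \<noteq> IJump a d) \<Longrightarrow> instr_skip x regs i = 0"
  by (cases i) auto

text \<open>Without jumps in \<open>P\<close> no skip is pending when \<open>P\<close> ends, so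
  \<open>Q\<close> simply continues from the registers of \<open>P\<close>.\<close>

lemma run_append:
  "straight_line P \<Longrightarrow> run w x 0 regs (P @ Q) = run w x 0 (run w x 0 regs P) Q"
  by (induction P arbitrary: regs) (auto simp: straight_line_def instr_skip_straight)

lemma length_run: "length (run w x s regs P) = length regs + length P"
  by (induction w x s regs P rule: run.induct) auto

lemma exec_conv_nth: "P \<noteq> [] \<Longrightarrow> exec w P x = run w x 0 [] P ! (length P - 1)"
  using length_run[of w x 0 "[]" P] by (auto simp: exec_def last_conv_nth)

lemma run_snoc:
  assumes "straight_line P" "\<forall>a d. i \<noteq> IJump a d"
  shows "run w x 0 [] (P @ [i]) = run w x 0 [] P @ [instr_eval w x (run w x 0 [] P) i]"
  using assms by (simp add: run_append)

lemma programs_snoc: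
  assumes "P \<in> programs w n" "straight_line P" "instr_wf w n (Suc (length P)) (length P) i"
  shows "P @ [i] \<in> programs w n"
proof -
  have "instr_wf w n (Suc (length P)) k (P ! k)" if "k < length P" for k
  proof -
    have "instr_wf w n (length P) k (P ! k)" using assms(1) that by (simp add: programs_def)
    then show ?thesis by (cases "P ! k") auto
  qed
  then show ?thesis using assms(3) by (auto simp: programs_def nth_append less_Suc_eq)
qed

text \<open>The test is appended without disturbing the registers of \<open>P\<close>, so that a
  later instruction can still refer to the result of \<open>P\<close>.\<close>

lemma program_extension_test:
  assumes w: "0 < w" and P: "P \<in> programs w n" "straight_line P"
    and "k \<le> n" and a: "\<And>j. j < n \<Longrightarrow> a j < 2 ^ w"
  shows "\<exists>Q. P @ Q \<in> programs w n \<and> straight_line (P @ Q) \<and> Q \<noteq> [] \<and>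
    (\<forall>x. \<exists>regs. run w x 0 [] (P @ Q) = run w x 0 [] P @ regs) \<and>
    (\<forall>x. exec w (P @ Q) x = of_bool (\<forall>j<k. x ! j = a j))"
  using \<open>k \<le> n\<close>
proof (induction k)
  case 0
  \<comment> \<open>The constant 1 is the empty conjunction; it also gives the test a result
    register to extend.\<close>
  let ?i = "IIte (Imm 1) (Imm 1) (Imm 1)"
  have "P @ [?i] \<in> programs w n" using w one_less_power[of "2::nat" w] by (intro programs_snoc P) simp
  then show ?case using P
    by (intro exI[of _ "[?i]"]) (auto simp: exec_def run_snoc straight_line_def)
next
  case (Suc k)
  then obtain Q where Q: "P @ Q \<in> programs w n" "straight_line (P @ Q)" "Q \<noteq> []"
    "\<And>x. \<exists>regs. run w x 0 [] (P @ Q) = run w x 0 [] P @ regs"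
    "\<And>x. exec w (P @ Q) x = of_bool (\<forall>j<k. x ! j = a j)" by auto
  let ?l = "length (P @ Q)"
  \<comment> \<open>The previous conjunction is in register \<open>?l - 1\<close>; the new
    comparison goes to register \<open>?l\<close>.\<close>
  let ?i = "IBin OEq (Inp k) (Imm (a k))" and ?i' = "IBin OAnd (Reg (?l - 1)) (Reg ?l)"
  have s: "straight_line ((P @ Q) @ [?i])" using Q(2) by (auto simp: straight_line_def)
  have 1: "(P @ Q) @ [?i] \<in> programs w n" using Q Suc.prems a by (intro programs_snoc) auto
  have 2: "((P @ Q) @ [?i]) @ [?i'] \<in> programs w n"
    using Q by (intro programs_snoc[OF 1 s]) auto
  have r: "run w x 0 [] (((P @ Q) @ [?i]) @ [?i']) =
    run w x 0 [] (P @ Q) @ [of_bool (x ! k = a k), of_bool (\<forall>j<Suc k. x ! j = a j)]" for x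
  proof -
    let ?R = "run w x 0 [] (P @ Q)"
    have "length ?R = ?l" using length_run[of w x 0 "[]" "P @ Q"] by simp
    moreover have "?R ! (?l - 1) = of_bool (\<forall>j<k. x ! j = a j)"
      using exec_conv_nth[of "P @ Q" w x] Q(3,5) by simp
    moreover have "?l - 1 < ?l" using Q(3) by simp
    moreover have R1: "run w x 0 [] ((P @ Q) @ [?i]) = ?R @ [of_bool (x ! k = a k)]"
      using w by (subst run_snoc[OF Q(2)]) (simp_all add: take_bit_of_bool)
    ultimately have "instr_eval w x (?R @ [of_bool (x ! k = a k)]) ?i' =
        of_bool (\<forall>j<Suc k. x ! j = a j)"
      using w by (simp add: nth_append less_Suc_eq_le le_less all_conj_distrib take_bit_of_bool)
    then show ?thesis using run_snoc[OF s, of ?i' w x] R1 by simp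
  qed
  show ?case
  proof (intro exI[of _ "Q @ [?i, ?i']"] conjI allI)
    show "P @ Q @ [?i, ?i'] \<in> programs w n" using 2 by simp
    show "straight_line (P @ Q @ [?i, ?i'])" using Q(2) by (auto simp: straight_line_def)
    show "\<exists>regs. run w x 0 [] (P @ Q @ [?i, ?i']) = run w x 0 [] P @ regs" for x
      using r[of x] Q(4)[of x] by auto
    show "exec w (P @ Q @ [?i, ?i']) x = of_bool (\<forall>j<Suc k. x ! j = a j)" for x
      using r[of x] by (simp add: exec_def)
  qed simp
qed

text \<open>After a test for the input \<open>a\<close>, one conditional selects between
  \<open>v\<close> and the old result, which sits in register \<open>length P - 1\<close>.\<close>

lemma program_update:
  assumes w: "0 < w" and P: "P \<in> programs w n" "straight_line P" "P \<noteq> []"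
    and a: "length a = n" "\<forall>c\<in>set a. c < 2 ^ w" and v: "v < 2 ^ w"
  shows "\<exists>P'\<in>programs w n. straight_line P' \<and> P' \<noteq> [] \<and>
    (\<forall>x. length x = n \<longrightarrow> exec w P' x = (if x = a then v else exec w P x))"
proof -
  obtain Q where Q: "P @ Q \<in> programs w n" "straight_line (P @ Q)" "Q \<noteq> []"
    "\<And>x. \<exists>regs. run w x 0 [] (P @ Q) = run w x 0 [] P @ regs"
    "\<And>x. exec w (P @ Q) x = of_bool (\<forall>j<n. x ! j = a ! j)"
    using program_extension_test[OF w P(1,2), of n "\<lambda>j. a ! j"] a by auto
  let ?l = "length (P @ Q)"
  let ?i = "IIte (Reg (?l - 1)) (Imm v) (Reg (length P - 1))"
  have "length P - 1 < ?l" using P(3) by (cases P) auto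
  then have 1: "(P @ Q) @ [?i] \<in> programs w n" using Q v by (intro programs_snoc) auto
  have e: "exec w ((P @ Q) @ [?i]) x = (if x = a then v else exec w P x)" if x: "length x = n" for x
  proof -
    obtain regs where regs: "run w x 0 [] (P @ Q) = run w x 0 [] P @ regs" using Q(4) by blast
    have "length P - 1 < length (run w x 0 [] P)" using P(3) length_run[of w x 0 "[]" P] by simp
    then have "run w x 0 [] (P @ Q) ! (length P - 1) = exec w P x"
      using regs exec_conv_nth[OF P(3)] by (simp add: nth_append)
    moreover have "run w x 0 [] (P @ Q) ! (?l - 1) = of_bool (\<forall>j<n. x ! j = a ! j)"
      using exec_conv_nth[of "P @ Q" w x] Q(3,5) by simp
    moreover have "(\<forall>j<n. x ! j = a ! j) \<longleftrightarrow> x = a" using x a by (auto simp: list_eq_iff_nth_eq)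
    ultimately have "instr_eval w x (run w x 0 [] (P @ Q)) ?i = (if x = a then v else exec w P x)"
      by simp
    then show ?thesis using run_snoc[OF Q(2), of ?i w x] by (simp add: exec_def)
  qed
  have "straight_line ((P @ Q) @ [?i])" using Q(2) by (auto simp: straight_line_def)
  with 1 e show ?thesis by (intro bexI[OF _ 1]) auto
qed

text \<open>There are only finitely many inputs, so the lookup table is built by updating a constant
  program at one argument after another.\<close>

lemma program_for_function:
  fixes f :: "nat list \<Rightarrow> nat"
  assumes w: "0 < w" and f: "\<And>x. f x < 2 ^ w"
  shows "\<exists>P\<in>programs w n. \<forall>x. length x = n \<and> (\<forall>c\<in>set x. c < 2 ^ w) \<longrightarrow> exec w P x = f x"
proof -
  let ?D = "{x :: nat list. length x = n \<and> (\<forall>c\<in>set x. c < 2 ^ w)}"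
  have "\<exists>P\<in>programs w n. straight_line P \<and> P \<noteq> [] \<and> (\<forall>x\<in>A. exec w P x = f x)"
    if "finite A" "A \<subseteq> ?D" for A
    using that
  proof (induction A)
    case empty
    have "[IIte (Imm 0) (Imm 0) (Imm 0)] \<in> programs w n" by (simp add: programs_def)
    then show ?case by (rule bexI[rotated]) (simp add: straight_line_def)
  next
    case (insert a A)
    then obtain P where P: "P \<in> programs w n" "straight_line P" "P \<noteq> []" "\<forall>x\<in>A. exec w P x = f x"
      by auto
    have "length a = n" "\<forall>c\<in>set a. c < 2 ^ w" using insert.prems by auto
    from program_update[OF w P(1-3) this f[of a]] obtain P' where "P' \<in> programs w n"
      "straight_line P'" "P' \<noteq> []"
      "\<forall>x. length x = n \<longrightarrow> exec w P' x = (if x = a then f a else exec w P x)" by blast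
    then show ?case using P(4) insert.prems by (intro bexI[of _ P']) auto
  qed
  note * = this
  have "?D = {x. set x \<subseteq> {..<2 ^ w} \<and> length x = n}" by auto
  then have "finite ?D" by (simp add: finite_lists_length_eq)
  from *[OF this subset_refl] show ?thesis by auto
qed

section \<open>Assignments and strategies as words\<close>

text \<open>The word \<open>1\<^sup>i 0 bs\<close>, least significant bit first, determines \<open>i\<close>; the arity of the \<open>i\<close>-th
  relation then determines the length of \<open>bs\<close>, hence \<open>bs\<close>.\<close>

primrec rel_word :: "nat \<Rightarrow> bool list \<Rightarrow> nat" where
  "rel_word 0 bs = 2 * horner_sum of_bool 2 bs"
| "rel_word (Suc i) bs = 1 + 2 * rel_word i bs"

lemma horner_sum_bits_less: "(horner_sum of_bool 2 bs :: nat) < 2 ^ length bs"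
  by (induction bs) auto

lemma horner_sum_bits_inject:
  "length bs = length bs' \<Longrightarrow> (horner_sum of_bool 2 bs :: nat) = horner_sum of_bool 2 bs' \<Longrightarrow> bs = bs'"
proof (induction bs bs' rule: list_induct2)
  case (Cons b bs b' bs')
  then have *: "of_bool b + 2 * horner_sum of_bool 2 bs = (of_bool b' + 2 * horner_sum of_bool 2 bs' :: nat)"
    by simp
  then have "b = b'" by (cases b; cases b') (simp_all, presburger+)
  with Cons * show ?case by simp
qed simp

lemma rel_word_less: "rel_word i bs < 2 ^ (Suc i + length bs)"
  by (induction i) (use horner_sum_bits_less[of bs] in auto)

lemma rel_word_inject:
  "rel_word i bs = rel_word i' bs' \<Longrightarrow>
     i = i' \<and> (horner_sum of_bool 2 bs :: nat) = horner_sum of_bool 2 bs'"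
proof (induction i arbitrary: i')
  case 0
  then show ?case by (cases i') (simp_all, presburger)
next
  case (Suc i)
  then show ?case by (cases i') (simp_all, presburger)
qed

section \<open>The lowest set bit of a word\<close>

text \<open>The borrow turns the zeros below the lowest set bit into ones, clears that bit and
  leaves the higher bits alone.\<close>

lemma bit_pred:
  fixes d :: nat
  assumes "bit d k" "\<forall>i<k. \<not> bit d i"
  shows "bit (d - 1) i \<longleftrightarrow> i < k \<or> k < i \<and> bit d i"
  using assms
proof (induction k arbitrary: d i)
  case 0
  then obtain c where "d = 2 * c + 1" by (auto simp: bit_0 elim: oddE)
  then show ?case by (cases i) (auto simp: bit_0 bit_Suc)
next
  case (Suc k)
  then have "even d" by (auto simp: bit_0)
  then obtain c where c: "d = 2 * c" by blast
  have k: "bit c k" "\<forall>i<k. \<not> bit c i" using Suc.prems by (auto simp: c bit_Suc)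
  then have "c \<noteq> 0" by (auto intro: Nat.gr0I)
  then have "d - 1 = 2 * (c - 1) + 1" by (simp add: c)
  then show ?case using Suc.IH[OF k] by (cases i) (auto simp: c bit_0 bit_Suc)
qed

text \<open>The lowest set bit is the only set bit of \<open>d\<close> that is not set in \<open>d - 1\<close>.\<close>

lemma lowest_bit_not_in_mask_iff:
  fixes d e :: nat
  shows "and (and d e) (d - 1) = and d e \<longleftrightarrow> (\<forall>k. bit d k \<and> (\<forall>i<k. \<not> bit d i) \<longrightarrow> \<not> bit e k)"
proof (cases "d = 0")
  case False
  then have "\<exists>k. bit d k" by (metis bit_eqI bit_0_eq bot_apply bot_bool_def)
  then obtain k where k: "bit d k" "\<forall>i<k. \<not> bit d i" by (metis exists_least_iff)
  have "and (and d e) (d - 1) = and d e \<longleftrightarrow> \<not> bit e k"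
    unfolding bit_eq_iff bit_and_iff bit_pred[OF k] using k
    by (auto simp: possible_bit_def) (metis linorder_neqE_nat)
  moreover have "l = k" if "bit d l" "\<forall>i<l. \<not> bit d i" for l
    using that k by (metis linorder_neqE_nat)
  ultimately show ?thesis using k by metis
qed simp

lemma bit_imp_less_width: "bit (a::nat) i \<Longrightarrow> a < 2 ^ w \<Longrightarrow> i < w"
  by (metis bit_take_bit_iff take_bit_nat_eq_self)

lemma horner_sum_bits_conv:
  "bit (horner_sum of_bool 2 bs :: nat) i \<longleftrightarrow> i < length bs \<and> bs ! i"
  by (simp add: bit_horner_sum_bit_iff)

section \<open>Strategies, plays and quantifier prefixes\<close>

text \<open>The word is the play in which the strategy \<open>st\<close> chooses the bits in the
  mask \<open>e\<close>, seeing all lower bits, and \<open>u\<close> supplies the others.\<close>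

lemma strategy_word_exists:
  fixes e u :: nat
  assumes e: "e < 2 ^ w" and u: "u < 2 ^ w"
  shows "\<exists>x::nat. x < 2 ^ w \<and> (\<forall>j. bit x j = (if bit e j then st j (map (bit x) [0..<j]) else bit u j))"
proof -
  \<comment> \<open>\<open>L k\<close> lists the first \<open>k\<close> bits of the play. Recursion
    is needed because \<open>st\<close> looks at earlier bits of the word under
    construction.\<close>
  define L where "L = rec_nat [] (\<lambda>k l. l @ [if bit e k then st k l else bit u k])"
  have L: "L 0 = []" "L (Suc k) = L k @ [if bit e k then st k (L k) else bit u k]" for k
    by (simp_all add: L_def)
  have len: "length (L k) = k" for k by (induction k) (simp_all add: L)
  have pre: "take j (L (j + k)) = L j" for j k by (induction k) (simp_all add: L len)
  have nth: "L w ! j = (if bit e j then st j (L j) else bit u j)" if "j < w" for j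
  proof -
    have "take (Suc j) (L w) = L (Suc j)" using pre[of "Suc j" "w - Suc j"] that by simp
    then have "L w ! j = L (Suc j) ! j" using nth_take[of j "Suc j" "L w"] by simp
    then show ?thesis by (simp add: L len nth_append)
  qed
  let ?x = "horner_sum of_bool 2 (L w) :: nat"
  have bits: "bit ?x j \<longleftrightarrow> j < w \<and> L w ! j" for j by (simp add: horner_sum_bits_conv len)
  have m: "map (bit ?x) [0..<j] = L j" if "j < w" for j
  proof -
    have "take j (L w) = L j" using pre[of j "w - j"] that by simp
    moreover have "map (bit ?x) [0..<j] = take j (L w)"
      using that by (intro nth_equalityI) (auto simp: len bits)
    ultimately show ?thesis by simp
  qed
  have "bit ?x j = (if bit e j then st j (map (bit ?x) [0..<j]) else bit u j)" for j
  proof (cases "j < w")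
    case True
    then show ?thesis using bits nth m by simp
  next
    case False
    then have "\<not> bit e j" "\<not> bit u j" using e u bit_imp_less_width by auto
    then show ?thesis using False bits by simp
  qed
  moreover have "?x < 2 ^ w" using horner_sum_bits_less[of "L w"] by (simp add: len)
  ultimately show ?thesis by blast
qed

text \<open>\<open>V\<close> is meant as the set of plays following some strategy. Backward
  induction shows that the rest of the prefix holds after every initial segment of every play in
  \<open>V\<close>; at an existential quantifier the play itself supplies the witness.\<close>

lemma prefix_holds_if_plays:
  fixes V :: "nat set"
  assumes R: "\<And>x. x \<in> V \<Longrightarrow> R (map (bit x) [0..<length qs])"
    and complete: "\<And>p. \<exists>x\<in>V. \<forall>j<length qs. qs ! j = QAll \<longrightarrow> bit x j = p j"
    and deterministic: "\<And>x x' k. x \<in> V \<Longrightarrow> x' \<in> V \<Longrightarrow> k < length qs \<Longrightarrow> qs ! k = QEx \<Longrightarrow>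
      \<forall>i<k. bit x i = bit x' i \<Longrightarrow> bit x k = bit x' k"
  shows "prefix_holds qs [] R"
proof -
  let ?n = "length qs"
  have "\<forall>x\<in>V. prefix_holds (drop k qs) (map (bit x) [0..<k]) R" if "k \<le> ?n" for k
    using that
  proof (induction k rule: inc_induct)
    case base
    then show ?case using R by simp
  next
    case (step k)
    show ?case
    proof
      fix x assume x: "x \<in> V"
      have d: "drop k qs = qs ! k # drop (Suc k) qs" using step.hyps by (simp add: Cons_nth_drop_Suc)
      show "prefix_holds (drop k qs) (map (bit x) [0..<k]) R"
      proof (cases "qs ! k")
        case QEx
        have "prefix_holds (drop (Suc k) qs) (map (bit x) [0..<k] @ [bit x k]) R"
          using step.IH x by simp
        then show ?thesis unfolding d QEx by auto
      next
        case QAll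
        have "prefix_holds (drop (Suc k) qs) (map (bit x) [0..<k] @ [b]) R" for b
        proof -
          \<comment> \<open>This play makes the same universal moves as \<open>x\<close>, except for
            \<open>b\<close> at position \<open>k\<close>.\<close>
          obtain x' where x': "x' \<in> V"
            "\<forall>j<?n. qs ! j = QAll \<longrightarrow> bit x' j = ((bit x)(k := b)) j" using complete by blast
          \<comment> \<open>Below \<open>k\<close> the universal bits agree by choice of
            \<open>x'\<close>, and the existential ones then agree by determinism.\<close>
          have "bit x' i = bit x i" if "i < k" for i
            using that
          proof (induction i rule: less_induct)
            case (less i)
            then have "i < ?n" using step.hyps by simp
            show ?case
            proof (cases "qs ! i")
              case QEx
              then show ?thesis using deterministic[OF x'(1) x \<open>i < ?n\<close>] less by simp
            next
              case QAll
              then show ?thesis using x'(2) \<open>i < ?n\<close> less.prems by simp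
            qed
          qed
          moreover have "bit x' k = b" using x'(2) step.hyps QAll by simp
          ultimately have "map (bit x') [0..<Suc k] = map (bit x) [0..<k] @ [b]" by simp
          moreover have "prefix_holds (drop (Suc k) qs) (map (bit x') [0..<Suc k]) R"
            using step.IH x'(1) by blast
          ultimately show ?thesis by metis
        qed
        then show ?thesis unfolding d QAll by simp
      qed
    qed
  qed
  \<comment> \<open>\<open>complete\<close> also provides a member of \<open>V\<close>, from which
    the empty initial segment is taken.\<close>
  from this[of 0] complete show ?thesis by auto
qed

text \<open>Choosing \<open>True\<close> exactly when \<open>True\<close> leaves a true remainder is
  a winning strategy, so every play following it ends in \<open>R\<close>.\<close>

lemma prefix_holds_play:
  fixes x :: nat
  assumes "prefix_holds qs [] R"
    and st: "\<And>j. j < length qs \<Longrightarrow> qs ! j = QEx \<Longrightarrow>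
      bit x j = prefix_holds (drop (Suc j) qs) (map (bit x) [0..<j] @ [True]) R"
  shows "R (map (bit x) [0..<length qs])"
proof -
  have "prefix_holds (drop k qs) (map (bit x) [0..<k]) R" if "k \<le> length qs" for k
    using that
  proof (induction k)
    case 0
    then show ?case using assms(1) by simp
  next
    case (Suc k)
    have d: "drop k qs = qs ! k # drop (Suc k) qs" using Suc.prems by (simp add: Cons_nth_drop_Suc)
    have IH: "prefix_holds (qs ! k # drop (Suc k) qs) (map (bit x) [0..<k]) R" using Suc d by simp
    show ?case
    proof (cases "qs ! k")
      case QEx
      with IH obtain b where b: "prefix_holds (drop (Suc k) qs) (map (bit x) [0..<k] @ [b]) R" by auto
      have "prefix_holds (drop (Suc k) qs) (map (bit x) [0..<k] @ [bit x k]) R"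
      proof (cases "bit x k")
        case True
        then show ?thesis using st[of k] QEx Suc.prems by simp
      next
        case False
        \<comment> \<open>The strategy chose \<open>False\<close>, so \<open>True\<close> does not
          win and the witness \<open>b\<close> must be \<open>False\<close>.\<close>
        then have "\<not> b" using b st[of k] QEx Suc.prems by (cases b) auto
        then show ?thesis using b False by simp
      qed
      then show ?thesis by simp
    next
      case QAll
      then show ?thesis using IH by simp
    qed
  qed
  from this[of "length qs"] show ?thesis by simp
qed

section \<open>The specification\<close>

text \<open>The bit is tested with the constant \<open>2 ^ j\<close> because its binary notation is
  the unary index with ticks replaced by zeros, followed by a one. A transducer can therefore copy
  it without counting.\<close>

definition bit_spec :: "nat \<Rightarrow> spec" where
  "bit_spec j = SBin OLt (SConst 0) (SBin OAnd (SInp 0) (SConst (2 ^ j)))"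

text \<open>Horner's scheme consumes the arguments in the order in which the atom lists them, and
  \<open>query_spec\<close> likewise consumes the unary index of the relation.\<close>

primrec args_spec :: "nat list \<Rightarrow> spec" where
  "args_spec [] = SConst 0"
| "args_spec (j # js) = SBin OAdd (bit_spec j) (SBin OMul (SConst 2) (args_spec js))"

primrec query_spec :: "nat \<Rightarrow> nat list \<Rightarrow> spec" where
  "query_spec 0 js = SBin OMul (SConst 2) (args_spec js)"
| "query_spec (Suc i) js = SBin OAdd (SConst 1) (SBin OMul (SConst 2) (query_spec i js))"

text \<open>All values are kept in 0 and 1, so \<open>OAnd\<close> and \<open>OOr\<close> act as
  connectives, \<open>OLe\<close> is implication and \<open>OEq\<close> is equivalence.\<close>

primrec form_spec :: "form \<Rightarrow> spec" where
  "form_spec (FVar j) = bit_spec j"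
| "form_spec (FRel i js) = SBin OLt (SConst 0) (SExec [SConst 1, SConst 0, query_spec i js])"
| "form_spec FTrue = SConst 1"
| "form_spec FFalse = SConst 0"
| "form_spec (FNot f) = SBin OEq (SConst 0) (form_spec f)"
| "form_spec (FAnd f g) = SBin OAnd (form_spec f) (form_spec g)"
| "form_spec (FOr f g) = SBin OOr (form_spec f) (form_spec g)"
| "form_spec (FImp f g) = SBin OLe (form_spec f) (form_spec g)"
| "form_spec (FIff f g) = SBin OEq (form_spec f) (form_spec g)"

text \<open>The exclusive or clears the existential positions and so leaves the universal moves as
  the argument of the strategy. Its reply is compared on the existential positions only.\<close>

definition valid_spec :: "nat \<Rightarrow> spec" where
  "valid_spec v =
     SBin OEq (SBin OAnd (SInp v) (SInp 2))
       (SBin OAnd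
         (SExec [SConst 0, SConst 0, SBin OXor (SInp v) (SBin OAnd (SInp v) (SInp 2))])
         (SInp 2))"

text \<open>The bits of \<open>d\<close> mark the positions where the two words differ. Its lowest
  set bit is the only one missing from \<open>d - 1\<close>, so the equation says that this bit lies
  outside the mask.\<close>

definition consistent_spec :: spec where
  "consistent_spec =
     (let d = SBin OXor (SInp 0) (SInp 1); de = SBin OAnd d (SInp 2)
      in SBin OEq (SBin OAnd de (SBin OSub d (SConst 1))) de)"

text \<open>The additional top bit makes the binary notation of the mask end with the last quantifier
  followed by a one, whatever the prefix is: \<^const>\<open>enc_bits\<close> drops leading zeros.\<close>

definition ex_mask :: "quantifier list \<Rightarrow> nat" where
  "ex_mask qs = horner_sum of_bool 2 (map (\<lambda>q. q = QEx) qs @ [True])"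

definition so_spec :: "so_sentence \<Rightarrow> spec" where
  "so_spec \<phi> =
     SBin OLe (SBin OEq (SInp 2) (SConst (ex_mask (so_prefix \<phi>))))
       (SBin OLe (valid_spec 0)
         (SBin OLe (valid_spec 1) (SBin OAnd consistent_spec (form_spec (so_matrix \<phi>)))))"

text \<open>Since indices are written in unary, the length of the sentence bounds all positions and
  query lengths that occur in it. The additional two guarantees that the constants 1 and 2 fit into
  a word.\<close>

definition so_synthesis :: "so_sentence \<Rightarrow> synthesis_instance" where
  "so_synthesis \<phi> =
     \<lparr>fs_width = length (enc_so \<phi>) + 2, fs_inputs = 3, fs_spec = so_spec \<phi>\<rparr>"

section \<open>Well-formedness of the synthesis instance\<close>

lemma ex_mask_less: "length qs < w \<Longrightarrow> ex_mask qs < 2 ^ w"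
  using horner_sum_bits_less[of "map (\<lambda>q. q = QEx) qs @ [True]"]
    power_increasing[of "Suc (length qs)" w "2::nat"]
  by (simp add: ex_mask_def)

lemma bit_ex_mask: "j < length qs \<Longrightarrow> bit (ex_mask qs) j \<longleftrightarrow> qs ! j = QEx"
  by (simp add: ex_mask_def horner_sum_bits_conv nth_append del: horner_sum_append)

lemma bits_less_width: "2 \<le> w \<Longrightarrow> 2 < (2::nat) ^ w" "2 \<le> w \<Longrightarrow> Suc 0 < 2 ^ w"
  using power_increasing[of 2 w "2::nat"] by simp_all

lemma length_enc_vars: "length (concat (map enc_var js)) = (\<Sum>j\<leftarrow>js. j + 2)"
  by (induction js) (auto simp: enc_var_def enc_unary_def)

lemma length_le_sum_add2: "length js \<le> (\<Sum>j::nat\<leftarrow>js. j + 2)"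
  by (induction js) auto

lemma mem_le_sum_add2: "j \<in> set js \<Longrightarrow> j < (\<Sum>j::nat\<leftarrow>js. j + 2)"
  by (induction js) auto

lemma spec_wf_bit_spec: "j < w \<Longrightarrow> 0 < n \<Longrightarrow> spec_wf w n (bit_spec j)"
  by (simp add: bit_spec_def)

lemma spec_wf_args_spec:
  "2 \<le> w \<Longrightarrow> 0 < n \<Longrightarrow> \<forall>j\<in>set js. j < w \<Longrightarrow> spec_wf w n (args_spec js)"
  by (induction js) (auto simp: spec_wf_bit_spec bits_less_width)

lemma spec_wf_query_spec:
  "2 \<le> w \<Longrightarrow> 0 < n \<Longrightarrow> \<forall>j\<in>set js. j < w \<Longrightarrow> spec_wf w n (query_spec i js)"
  by (induction i) (auto simp: spec_wf_args_spec bits_less_width)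

text \<open>An index \<open>j\<close> occupies more than \<open>j\<close> tokens of the encoding, so
  the width exceeds it and the constant \<open>2 ^ j\<close> fits.\<close>

lemma spec_wf_form_spec:
  assumes "2 \<le> w" "length (enc_form f) \<le> w"
  shows "spec_wf w 3 (form_spec f)"
  using assms(2)
proof (induction f)
  case (FVar j)
  then show ?case by (simp add: spec_wf_bit_spec enc_var_def enc_unary_def)
next
  case (FRel i js)
  then have "\<forall>j\<in>set js. j < w" using mem_le_sum_add2[of _ js]
    by (fastforce simp: length_enc_vars)
  then show ?case using assms(1) by (simp add: spec_wf_query_spec bits_less_width)
qed (use assms(1) in \<open>simp_all add: bits_less_width\<close>)

lemma length_enc_form_pos: "0 < length (enc_form f)"
  by (cases f) (auto simp: enc_var_def)

lemma length_enc_so_ge: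
  "length (so_prefix \<phi>) + length (enc_form (so_matrix \<phi>)) \<le> length (enc_so \<phi>)"
  by (simp add: enc_so_def)

lemma fs_wf_so_synthesis: "fs_wf (so_synthesis \<phi>)"
proof -
  let ?w = "length (enc_so \<phi>) + 2"
  have "ex_mask (so_prefix \<phi>) < 2 ^ ?w"
    using length_enc_so_ge[of \<phi>] by (intro ex_mask_less) simp
  moreover have "spec_wf ?w 3 (form_spec (so_matrix \<phi>))"
    using length_enc_so_ge[of \<phi>] by (intro spec_wf_form_spec) auto
  moreover have "Suc 0 < 2 ^ ?w" by (rule bits_less_width) simp
  ultimately show ?thesis
    by (simp add: fs_wf_def so_synthesis_def so_spec_def valid_spec_def consistent_spec_def Let_def)
qed

section \<open>Evaluation of the specification without overflow\<close>

lemma take_bit_and_self: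
  fixes a b :: nat
  assumes "b < 2 ^ w"
  shows "take_bit w (and a b) = and a b"
  using assms by (auto simp: bit_eq_iff bit_take_bit_iff bit_and_iff intro: bit_imp_less_width)

lemma take_bit_xor_self:
  fixes a b :: nat
  assumes "a < 2 ^ w" "b < 2 ^ w"
  shows "take_bit w (xor a b) = xor a b"
  using assms by (simp add: take_bit_nat_eq_self)

lemma xor_less: "a < 2 ^ w \<Longrightarrow> b < 2 ^ w \<Longrightarrow> xor a b < (2::nat) ^ w"
  by (metis take_bit_xor_self take_bit_nat_less_exp)

lemma and_less: "b < 2 ^ w \<Longrightarrow> and a b < (2::nat) ^ w"
  by (metis take_bit_and_self take_bit_nat_less_exp)

lemma spec_eval_bit_spec:
  assumes "j < w"
  shows "spec_eval w P x (bit_spec j) = of_bool (bit (x ! 0) j)"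
proof -
  have "take_bit w (and (x ! 0) (2 ^ j)) = and (x ! 0) (2 ^ j)"
    using assms by (intro take_bit_and_self) simp
  then show ?thesis using assms
    by (simp add: bit_spec_def take_bit_of_bool and_exp_eq_0_iff_not_bit[symmetric])
qed

lemma spec_eval_args_spec:
  assumes "\<forall>j\<in>set js. j < w" "length js \<le> w"
  shows "spec_eval w P x (args_spec js) = horner_sum of_bool 2 (map (bit (x ! 0)) js)"
  using assms
proof (induction js)
  case (Cons j js)
  let ?h = "horner_sum of_bool 2 (map (bit (x ! 0)) js) :: nat"
  have "?h < 2 ^ length js" using horner_sum_bits_less[of "map (bit (x ! 0)) js"] by simp
  moreover have "(2::nat) * 2 ^ length js \<le> 2 ^ w"
    using Cons.prems(2) power_increasing[of "Suc (length js)" w "2::nat"] by simp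
  ultimately have "of_bool (bit (x ! 0) j) + 2 * ?h < 2 ^ w" by (cases "bit (x ! 0) j") auto
  then show ?case using Cons by (simp add: spec_eval_bit_spec take_bit_nat_eq_self)
qed simp

lemma spec_eval_query_spec:
  assumes "\<forall>j\<in>set js. j < w" "Suc i + length js \<le> w"
  shows "spec_eval w P x (query_spec i js) = rel_word i (map (bit (x ! 0)) js)"
  using assms(2)
proof (induction i)
  case 0
  have "rel_word 0 (map (bit (x ! 0)) js) < 2 ^ w"
    using rel_word_less[of 0 "map (bit (x ! 0)) js"] power_increasing[OF 0, of "2::nat"] by simp
  then show ?case using spec_eval_args_spec[of js w P x] assms(1) 0 by (simp add: take_bit_nat_eq_self)
next
  case (Suc i)
  have "rel_word (Suc i) (map (bit (x ! 0)) js) < 2 ^ w"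
    using rel_word_less[of "Suc i" "map (bit (x ! 0)) js"] power_increasing[OF Suc.prems, of "2::nat"]
    by (simp del: rel_word.simps)
  then show ?case using Suc by (simp add: take_bit_nat_eq_self)
qed

text \<open>The program must agree with \<open>S\<close> on query words of at most \<open>w\<close>
  bits; the query of every atom in \<open>f\<close> is that short because the encoding of
  \<open>f\<close> contains its index in unary and all its arguments.\<close>

lemma spec_eval_form_spec:
  assumes "0 < w" "length (enc_form f) \<le> w" "form_wf ars n f" "n \<le> w"
    and rels: "\<And>i bs. i < length ars \<Longrightarrow> length bs = ars ! i \<Longrightarrow> Suc i + length bs \<le> w \<Longrightarrow>
      exec w P [1, 0, rel_word i bs] \<noteq> 0 \<longleftrightarrow> bs \<in> S ! i"
  shows "spec_eval w P x (form_spec f) = of_bool (form_eval S (map (bit (x ! 0)) [0..<n]) f)"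
  using assms(2,3)
proof (induction f)
  case (FVar j)
  then show ?case using \<open>n \<le> w\<close> by (simp add: spec_eval_bit_spec)
next
  case (FRel i js)
  let ?bs = "map (bit (x ! 0)) js"
  have j: "\<forall>j\<in>set js. j < w" using FRel.prems \<open>n \<le> w\<close> by auto
  have l: "Suc i + length js \<le> w"
    using FRel.prems(1) length_le_sum_add2[of js] by (simp add: length_enc_vars enc_unary_def)
  have "map (\<lambda>j. map (bit (x ! 0)) [0..<n] ! j) js = ?bs" using FRel.prems by auto
  then have "form_eval S (map (bit (x ! 0)) [0..<n]) (FRel i js) \<longleftrightarrow> ?bs \<in> S ! i"
    by (simp only: form_eval.simps)
  then show ?case using rels[of i ?bs] FRel.prems l \<open>0 < w\<close>
    by (simp add: spec_eval_query_spec[OF j l] take_bit_of_bool del: form_eval.simps)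
qed (use \<open>0 < w\<close> in \<open>auto simp: take_bit_of_bool\<close>)

definition valid_word :: "nat \<Rightarrow> program \<Rightarrow> nat \<Rightarrow> nat \<Rightarrow> bool" where
  "valid_word w P e x \<longleftrightarrow> and x e = and (exec w P [0, 0, xor x (and x e)]) e"

definition deterministic_words :: "nat \<Rightarrow> nat \<Rightarrow> nat \<Rightarrow> bool" where
  "deterministic_words e x x' \<longleftrightarrow>
     (\<forall>k. bit e k \<and> (\<forall>i<k. bit x i = bit x' i) \<longrightarrow> bit x k = bit x' k)"

lemma spec_eval_valid_spec:
  assumes "0 < w" "x ! v < 2 ^ w" "x ! 2 < 2 ^ w"
  shows "spec_eval w P x (valid_spec v) = of_bool (valid_word w P (x ! 2) (x ! v))"
  using assms
  by (simp add: valid_spec_def valid_word_def take_bit_and_self take_bit_xor_self and_less take_bit_of_bool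
      del: take_bit_and take_bit_xor)

lemma take_bit_pred:
  assumes "d \<noteq> 0" "d < 2 ^ w"
  shows "take_bit w (2 ^ w + d - Suc 0) = d - Suc 0"
proof -
  obtain c where "d = Suc c" using assms(1) by (cases d) auto
  then show ?thesis using assms(2) by (simp add: take_bit_eq_mod)
qed

lemma spec_eval_consistent_spec:
  assumes "0 < w" "x ! 0 < 2 ^ w" "x ! 1 < 2 ^ w" "x ! 2 < 2 ^ w"
  shows "spec_eval w P x consistent_spec = of_bool (deterministic_words (x ! 2) (x ! 0) (x ! 1))"
proof -
  define d where "d = xor (x ! 0) (x ! 1)"
  have d: "d < 2 ^ w" using assms by (simp add: xor_less d_def)
  \<comment> \<open>For \<open>d = 0\<close> the word subtraction wraps around while subtraction on
    naturals gives 0, but both results are masked by \<open>d\<close>.\<close>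
  have "and (and d (x ! 2)) (take_bit w (2 ^ w + d - Suc 0)) = and (and d (x ! 2)) (d - Suc 0)"
    using take_bit_pred[OF _ d] by (cases "d = 0") simp_all
  then have 1: "and (and d (x ! 2)) (take_bit w (2 ^ w + d - Suc 0)) = and d (x ! 2) \<longleftrightarrow>
      (\<forall>k. bit d k \<and> (\<forall>i<k. \<not> bit d i) \<longrightarrow> \<not> bit (x ! 2) k)"
    using lowest_bit_not_in_mask_iff[of d "x ! 2"] by simp
  have 2: "deterministic_words (x ! 2) (x ! 0) (x ! 1) \<longleftrightarrow>
      (\<forall>k. bit d k \<and> (\<forall>i<k. \<not> bit d i) \<longrightarrow> \<not> bit (x ! 2) k)"
    unfolding deterministic_words_def d_def bit_xor_iff by blast
  have x: "take_bit w (xor (x ! 0) (x ! Suc 0)) = d"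
    using assms take_bit_xor_self[of "x ! 0" w "x ! 1"] by (simp add: d_def del: take_bit_xor)
  have a: "take_bit w (and d (x ! 2)) = and d (x ! 2)" using assms by (intro take_bit_and_self)
  have b: "take_bit w (and (and d (x ! 2)) (take_bit w (2 ^ w + d - Suc 0))) =
      and (and d (x ! 2)) (take_bit w (2 ^ w + d - Suc 0))" by (intro take_bit_and_self) simp
  show ?thesis unfolding 2 1[symmetric] using \<open>0 < w\<close>
    by (simp add: consistent_spec_def Let_def x a b take_bit_of_bool del: take_bit_and take_bit_xor)
qed

text \<open>This is the interface between word arithmetic and the game: both directions of the
  reduction use it, each with its own link between \<open>P\<close> and \<open>S\<close>.\<close>

lemma spec_eval_so_spec:
  assumes "so_wf \<phi>" and w: "w = length (enc_so \<phi>) + 2"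
    and x: "x < 2 ^ w" "x' < 2 ^ w" "c < 2 ^ w"
    and rels: "\<forall>i<length (so_arities \<phi>). \<forall>bs. length bs = so_arities \<phi> ! i \<longrightarrow>
      Suc i + length bs \<le> w \<longrightarrow> (exec w P [1, 0, rel_word i bs] \<noteq> 0 \<longleftrightarrow> bs \<in> S ! i)"
  shows "spec_eval w P [x, x', c] (so_spec \<phi>) \<noteq> 0 \<longleftrightarrow>
    (c = ex_mask (so_prefix \<phi>) \<longrightarrow> valid_word w P c x \<longrightarrow> valid_word w P c x' \<longrightarrow>
      deterministic_words c x x' \<and>
      form_eval S (map (bit x) [0..<length (so_prefix \<phi>)]) (so_matrix \<phi>))"
proof -
  have "0 < w" using w by simp
  have "spec_eval w P [x, x', c] (form_spec (so_matrix \<phi>)) =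
      of_bool (form_eval S (map (bit x) [0..<length (so_prefix \<phi>)]) (so_matrix \<phi>))"
    using spec_eval_form_spec[of w "so_matrix \<phi>" "so_arities \<phi>" "length (so_prefix \<phi>)" P S "[x, x', c]"]
      assms(1) rels w length_enc_so_ge[of \<phi>] by (simp add: so_wf_def)
  moreover have "spec_eval w P [x, x', c] (valid_spec 0) = of_bool (valid_word w P c x)"
    "spec_eval w P [x, x', c] (valid_spec 1) = of_bool (valid_word w P c x')"
    using spec_eval_valid_spec[of w "[x, x', c]" _ P] x \<open>0 < w\<close> by simp_all
  moreover have "spec_eval w P [x, x', c] consistent_spec = of_bool (deterministic_words c x x')"
    using spec_eval_consistent_spec[of w "[x, x', c]" P] x \<open>0 < w\<close> by simp
  ultimately show ?thesis using \<open>0 < w\<close>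
    by (auto simp: so_spec_def take_bit_of_bool)
qed

section \<open>Correctness of the reduction\<close>

lemma bit_xor_and: "bit (xor x (and x e)) j \<longleftrightarrow> bit x j \<and> \<not> bit e j" for x e :: nat
  by (auto simp: bit_xor_iff bit_and_iff)

lemma or_less: "a < 2 ^ w \<Longrightarrow> b < 2 ^ w \<Longrightarrow> or a b < (2::nat) ^ w"
  by (metis take_bit_nat_eq_self_iff take_bit_or)

text \<open>The program is the lookup table of a function \<open>f\<close> that answers queries
  about the true relations \<open>S\<close> and plays a winning strategy for them.\<close>

lemma fs_true_so_synthesis_if:
  assumes "so_wf \<phi>" "so_true \<phi>"
  shows "fs_true (so_synthesis \<phi>)"
proof -
  define w where "w = length (enc_so \<phi>) + 2"
  define qs where "qs = so_prefix \<phi>"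
  define ars where "ars = so_arities \<phi>"
  define e where "e = ex_mask qs"
  have e: "e < 2 ^ w" unfolding e_def w_def qs_def
    using length_enc_so_ge[of \<phi>] by (intro ex_mask_less) simp
  obtain S where S: "prefix_holds qs [] (\<lambda>x. form_eval S x (so_matrix \<phi>))"
    using assms(2) by (auto simp: so_true_def qs_def)
  let ?R = "\<lambda>x. form_eval S x (so_matrix \<phi>)"
  \<comment> \<open>The guard on \<open>j\<close> fixes the answer \<open>False\<close> at the
    additional top bit of the mask, which belongs to no quantifier.\<close>
  define st where "st j p \<longleftrightarrow> j < length qs \<and> prefix_holds (drop (Suc j) qs) (p @ [True]) ?R" for j p
  define play where "play u x \<longleftrightarrow> x < 2 ^ w \<and>
    (\<forall>j. bit x j = (if bit e j then st j (map (bit x) [0..<j]) else bit u j))" for u x :: nat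
  define F where "F u = (SOME x. play u x)" for u
  have F: "play u (F u)" if "u < 2 ^ w" for u
    unfolding F_def using strategy_word_exists[OF e that, of st]
    by (intro someI_ex[of "play u"]) (simp add: play_def)
  \<comment> \<open>The first input tells strategy calls from relation queries. A strategy call
    returns the entire play, which the specification masks with \<open>e\<close>; the default 0
    keeps all values within the word width.\<close>
  define f where "f y = (if y ! 0 = 0 then (if y ! 2 < 2 ^ w then F (y ! 2) else 0)
    else of_bool (\<exists>i bs. i < length ars \<and> length bs = ars ! i \<and> y ! 2 = rel_word i bs \<and> bs \<in> S ! i))"
    for y :: "nat list"
  have "f y < 2 ^ w" for y
    using F[of "y ! 2"] bits_less_width(2)[of w] by (auto simp: f_def play_def) (simp add: w_def)
  moreover have "0 < w" by (simp add: w_def)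
  ultimately obtain P where P: "P \<in> programs w 3"
    "\<And>y. length y = 3 \<Longrightarrow> \<forall>c\<in>set y. c < 2 ^ w \<Longrightarrow> exec w P y = f y"
    using program_for_function[of w f 3] by blast
  have rels: "exec w P [1, 0, rel_word i bs] \<noteq> 0 \<longleftrightarrow> bs \<in> S ! i"
    if "i < length ars" "length bs = ars ! i" "Suc i + length bs \<le> w" for i bs
  proof -
    have "rel_word i bs < 2 ^ w"
      using rel_word_less[of i bs] power_increasing[OF that(3), of "2::nat"] by simp
    then have "exec w P [1, 0, rel_word i bs] = f [1, 0, rel_word i bs]"
      using bits_less_width(2)[of w] by (intro P(2)) (auto simp: w_def)
    moreover have "i' = i \<and> bs' = bs"
      if "length bs' = ars ! i'" "rel_word i bs = rel_word i' bs'" for i' bs'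
      using rel_word_inject[OF that(2)] horner_sum_bits_inject[of bs' bs] that(1) \<open>length bs = ars ! i\<close>
      by auto
    ultimately show ?thesis using that(1,2) by (auto simp: f_def)
  qed
  then have rels': "\<forall>i<length (so_arities \<phi>). \<forall>bs. length bs = so_arities \<phi> ! i \<longrightarrow>
      Suc i + length bs \<le> w \<longrightarrow> (exec w P [1, 0, rel_word i bs] \<noteq> 0 \<longleftrightarrow> bs \<in> S ! i)"
    by (simp add: ars_def)
  \<comment> \<open>A valid word is the play \<open>F u\<close> on its own universal moves: outside
    \<open>e\<close> both have the bits of \<open>u\<close>, inside by validity.
    \<open>play x x\<close> restricts only the existential bits, since the others are prescribed by
    \<open>x\<close> itself.\<close>
  have valid: "play x x" if x: "x < 2 ^ w" "valid_word w P e x" for x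
  proof -
    define u where "u = xor x (and x e)"
    have u: "u < 2 ^ w" using x(1) e by (simp add: u_def xor_less and_less)
    then have "exec w P [0, 0, u] = F u" using P(2)[of "[0, 0, u]"] by (simp add: f_def)
    then have eq: "and x e = and (F u) e" using x(2) by (simp add: valid_word_def u_def)
    have "bit x j = bit (F u) j" for j
    proof (cases "bit e j")
      case True
      then show ?thesis using eq by (metis bit_and_iff)
    next
      case False
      then have "bit (F u) j = bit u j" using F[OF u] by (simp add: play_def)
      then show ?thesis using False by (simp add: u_def bit_xor_and)
    qed
    then have "F u = x" by (auto intro: bit_eqI)
    then show ?thesis using F[OF u] by (auto simp: play_def)
  qed
  have "spec_eval w P [x, x', c] (so_spec \<phi>) \<noteq> 0"
    if x: "x < 2 ^ w" "x' < 2 ^ w" "c < 2 ^ w" for x x' c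
    unfolding spec_eval_so_spec[OF assms(1) w_def x rels']
  proof (intro impI conjI)
    assume "c = ex_mask (so_prefix \<phi>)"
    then have c: "c = e" by (simp add: e_def qs_def)
    assume "valid_word w P c x" "valid_word w P c x'"
    then have p: "play x x" "play x' x'" using valid x c by auto
    have st: "bit y j = st j (map (bit y) [0..<j])" if "play y y" "bit e j" for y j
      using that unfolding play_def by meson
    show "deterministic_words c x x'"
      unfolding deterministic_words_def c
    proof (intro allI impI, elim conjE)
      fix k assume k: "bit e k" "\<forall>i<k. bit x i = bit x' i"
      \<comment> \<open>Both plays present the same history to the strategy, hence receive the same
        choice at \<open>k\<close>.\<close>
      have "map (bit x) [0..<k] = map (bit x') [0..<k]" using k(2) by simp
      then show "bit x k = bit x' k" using st[OF p(1) k(1)] st[OF p(2) k(1)] by metis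
    qed
    have "?R (map (bit x) [0..<length qs])"
    proof (rule prefix_holds_play[OF S])
      fix j assume j: "j < length qs" "qs ! j = QEx"
      then have "bit e j" by (simp add: e_def bit_ex_mask)
      from st[OF p(1) this] j(1)
      show "bit x j = prefix_holds (drop (Suc j) qs) (map (bit x) [0..<j] @ [True]) ?R"
        unfolding st_def by blast
    qed
    then show "form_eval S (map (bit x) [0..<length (so_prefix \<phi>)]) (so_matrix \<phi>)"
      by (simp add: qs_def)
  qed
  moreover have fs: "fs_width (so_synthesis \<phi>) = w" "fs_inputs (so_synthesis \<phi>) = 3"
    "fs_spec (so_synthesis \<phi>) = so_spec \<phi>" by (simp_all add: so_synthesis_def w_def)
  ultimately have "\<forall>y\<in>fs_domain (so_synthesis \<phi>). spec_eval w P y (so_spec \<phi>) \<noteq> 0"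
    by (auto simp: fs_domain_def numeral_3_eq_3 length_Suc_conv)
  then show ?thesis using P(1) fs unfolding fs_true_def finite_synthesis_def by metis
qed

text \<open>The relations are read off from the answers of the program, and its valid words form the
  set of plays to which \<open>prefix_holds_if_plays\<close> applies.\<close>

lemma so_true_if_fs_true_so_synthesis:
  assumes "so_wf \<phi>" "fs_true (so_synthesis \<phi>)"
  shows "so_true \<phi>"
proof -
  define w where "w = length (enc_so \<phi>) + 2"
  define qs where "qs = so_prefix \<phi>"
  define ars where "ars = so_arities \<phi>"
  define e where "e = ex_mask qs"
  have len: "length qs < w" using length_enc_so_ge[of \<phi>] by (simp add: w_def qs_def)
  then have e: "e < 2 ^ w" unfolding e_def by (rule ex_mask_less)
  obtain P where "\<forall>y\<in>fs_domain (so_synthesis \<phi>). spec_eval w P y (so_spec \<phi>) \<noteq> 0"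
    using assms(2) unfolding fs_true_def finite_synthesis_def by (auto simp: so_synthesis_def w_def)
  then have P: "spec_eval w P [x, x', e] (so_spec \<phi>) \<noteq> 0" if "x < 2 ^ w" "x' < 2 ^ w" for x x'
    using that e by (simp add: fs_domain_def so_synthesis_def w_def)
  define S where "S = map (\<lambda>i. {bs. length bs = ars ! i \<and> exec w P [1, 0, rel_word i bs] \<noteq> 0})
    [0..<length ars]"
  have rels: "\<forall>i<length (so_arities \<phi>). \<forall>bs. length bs = so_arities \<phi> ! i \<longrightarrow>
      Suc i + length bs \<le> w \<longrightarrow> (exec w P [1, 0, rel_word i bs] \<noteq> 0 \<longleftrightarrow> bs \<in> S ! i)"
    by (simp add: S_def ars_def)
  define V where "V = {x. x < 2 ^ w \<and> valid_word w P e x}"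
  have V: "deterministic_words e x x' \<and> form_eval S (map (bit x) [0..<length qs]) (so_matrix \<phi>)"
    if "x \<in> V" "x' \<in> V" for x x'
  proof -
    have x: "x < 2 ^ w" "x' < 2 ^ w" "valid_word w P e x" "valid_word w P e x'"
      using that by (auto simp: V_def)
    from P[OF x(1,2), unfolded spec_eval_so_spec[OF assms(1) w_def x(1,2) e rels]] x(3,4)
    show ?thesis by (simp add: e_def qs_def)
  qed
  have complete: "\<exists>x\<in>V. \<forall>j<length qs. qs ! j = QAll \<longrightarrow> bit x j = p j" for p
  proof -
    \<comment> \<open>The play with universal moves \<open>p\<close> is assembled here:
      \<open>u\<close> keeps the moves outside the mask, \<open>y\<close> is the reply of the
      strategy, and \<open>x\<close> merges the two.\<close>
    define v :: nat where "v = horner_sum of_bool 2 (map p [0..<length qs])"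
    have "v < 2 ^ length qs" using horner_sum_bits_less[of "map p [0..<length qs]"] by (simp add: v_def)
    also have "\<dots> \<le> 2 ^ w" using len by (intro power_increasing) auto
    finally have "v < 2 ^ w" .
    define u where "u = xor v (and v e)"
    define y where "y = exec w P [0, 0, u]"
    define x where "x = or u (and y e)"
    have bx: "bit x j \<longleftrightarrow> (if bit e j then bit y j else bit v j)" for j
      by (auto simp: x_def u_def bit_or_iff bit_and_iff bit_xor_iff)
    have "x < 2 ^ w" unfolding x_def u_def using \<open>v < 2 ^ w\<close> e
      by (intro or_less xor_less and_less)
    moreover have "and x e = and y e" by (rule bit_eqI) (auto simp: bit_and_iff bx)
    moreover have "xor x (and x e) = u"
      by (rule bit_eqI) (auto simp: bit_xor_and bx u_def simp del: bit_and_iff bit_xor_iff)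
    ultimately have "x \<in> V" by (simp add: V_def valid_word_def y_def)
    moreover have "bit x j = p j" if "j < length qs" "qs ! j = QAll" for j
      using that bx[of j] bit_ex_mask[of j qs] by (simp add: e_def v_def horner_sum_bits_conv)
    ultimately show ?thesis by blast
  qed
  have "prefix_holds qs [] (\<lambda>x. form_eval S x (so_matrix \<phi>))"
  proof (rule prefix_holds_if_plays[OF _ complete])
    show "form_eval S (map (bit x) [0..<length qs]) (so_matrix \<phi>)" if "x \<in> V" for x
      using V[OF that that] by simp
    fix x x' k
    assume "x \<in> V" "x' \<in> V" "k < length qs" "qs ! k = QEx" "\<forall>i<k. bit x i = bit x' i"
    then show "bit x k = bit x' k"
      using V[of x x'] bit_ex_mask[of k qs] unfolding deterministic_words_def e_def by blast
  qed
  moreover have "list_all2 (\<lambda>R a. R \<subseteq> {bs. length bs = a}) S ars"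
    by (auto simp: list_all2_conv_all_nth S_def)
  ultimately show ?thesis by (auto simp: so_true_def qs_def ars_def)
qed

section \<open>The transducer writing the specification\<close>

lemma enc_bits_zero: "enc_bits 0 = []"
  by (simp add: enc_bits.simps)

lemma enc_bits_Bit: "0 < of_bool b + 2 * m \<Longrightarrow> enc_bits (of_bool b + 2 * m) = TBit b # enc_bits m"
  by (subst enc_bits.simps) auto

lemma enc_bits_horner_sum: "enc_bits (horner_sum of_bool 2 (bs @ [True])) = map TBit (bs @ [True])"
proof (induction bs)
  case Nil
  then show ?case using enc_bits_Bit[of True 0] by (simp add: enc_bits_zero)
next
  case (Cons b bs)
  have "0 < (horner_sum of_bool 2 (bs @ [True]) :: nat)"
    by (induction bs) auto
  then show ?case using Cons enc_bits_Bit[of b "horner_sum of_bool 2 (bs @ [True])"]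
    by (simp del: horner_sum_append)
qed

lemma enc_bits_ex_mask: "enc_bits (ex_mask qs) = map (\<lambda>q. TBit (q = QEx)) qs @ [TBit True]"
  unfolding ex_mask_def enc_bits_horner_sum by simp

lemma enc_bits_power: "enc_bits (2 ^ j) = replicate j (TBit False) @ [TBit True]"
proof (induction j)
  case 0
  then show ?case using enc_bits_Bit[of True 0] by (simp add: enc_bits_zero)
next
  case (Suc j)
  then show ?case using enc_bits_Bit[of False "2 ^ j"] by simp
qed

lemma enc_bits_small: "enc_bits (Suc 0) = [TBit True]" "enc_bits 2 = [TBit False, TBit True]"
  using enc_bits_power[of 0] enc_bits_power[of 1] by simp_all

section \<open>Output blocks and modes of the transducer\<close>

text \<open>These tokens of \<open>enc_spec (bit_spec j)\<close> precede the binary digits of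
  \<open>2 ^ j\<close>; the constant 0 has no digits.\<close>

definition bit_prefix :: "token list" where
  "bit_prefix = [TBin OLt, TConst, TEnd, TBin OAnd, TVar, TEnd, TConst]"

definition twice_prefix :: "token list" where
  "twice_prefix = [TBin OMul, TConst, TBit False, TBit True, TEnd]"

text \<open>The header completes the unary width with its two extra ticks and stops right before the
  digits of the mask; \<open>spec_middle\<close> resumes with the top bit of the mask and stops
  right before the matrix.\<close>

definition spec_header :: "token list" where
  "spec_header = [TTick, TTick, TEnd] @ enc_unary 3 @ [TBin OLe, TBin OEq] @ enc_var 2 @ [TConst]"

definition spec_middle :: "token list" where
  "spec_middle = [TBit True, TEnd, TBin OLe] @ enc_spec (valid_spec 0) @
     [TBin OLe] @ enc_spec (valid_spec 1) @ [TBin OAnd] @ enc_spec consistent_spec"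

fun matrix_step :: "token \<Rightarrow> nat \<times> token list" where
  "matrix_step TVar = (5, bit_prefix)"
| "matrix_step TRel =
     (6, [TBin OLt, TConst, TEnd, TExec, TConst, TBit True, TEnd, TConst, TEnd])"
| "matrix_step TTrue = (4, [TConst, TBit True, TEnd])"
| "matrix_step TFalse = (4, [TConst, TEnd])"
| "matrix_step TNot = (4, [TBin OEq, TConst, TEnd])"
| "matrix_step TAnd = (4, [TBin OAnd])"
| "matrix_step TOr = (4, [TBin OOr])"
| "matrix_step TImp = (4, [TBin OLe])"
| "matrix_step TIff = (4, [TBin OEq])"
| "matrix_step _ = (1, [])"

text \<open>The first token of the matrix is only detected here: \<open>MStay\<close> leaves it to
  be read again in mode 4.\<close>

fun scan_step :: "token \<Rightarrow> nat \<times> move \<times> token list" where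
  "scan_step TDecl = (3, MRight, [])"
| "scan_step TTick = (3, MRight, [])"
| "scan_step TEnd = (3, MRight, [])"
| "scan_step (TQuant q) = (3, MRight, [TBit (q = QEx)])"
| "scan_step _ = (4, MStay, spec_middle)"

text \<open>Mode \<open>0\<close> writes the width, \<open>2\<close> rewinds the input, \<open>3\<close> reads the declarations and the prefix,
  \<open>4\<close> expects a formula, \<open>5\<close> reads the index of a variable, \<open>6\<close> that of a relation symbol, \<open>7\<close>
  expects an argument of an atom and \<open>8\<close> reads its index.\<close>

definition so_transducer :: "token transducer" where
  "so_transducer q s = (case s of
     None \<Rightarrow>
       (if q = 0 then (2, MLeft, spec_header) else if q = 2 then (3, MRight, []) else (1, MStay, []))
   | Some t \<Rightarrow>
       (if q = 0 then (0, MRight, [TTick])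
        else if q = 2 then (2, MLeft, [])
        else if q = 3 then scan_step t
        else if q = 4 then (fst (matrix_step t), MRight, snd (matrix_step t))
        else if q = 5 then
          (if t = TTick then (5, MRight, [TBit False]) else (4, MRight, [TBit True, TEnd]))
        else if q = 6 then
          (if t = TTick then (6, MRight, [TBin OAdd, TConst, TBit True, TEnd] @ twice_prefix)
           else (7, MRight, twice_prefix))
        else if q = 7 then
          (if t = TVar then (8, MRight, TBin OAdd # bit_prefix) else (4, MRight, [TConst, TEnd, TEnd]))
        else if q = 8 then
          (if t = TTick then (8, MRight, [TBit False])
           else (7, MRight, [TBit True, TEnd] @ twice_prefix))
        else (1, MStay, [])))"

lemma fst_matrix_step: "fst (matrix_step t) < 9"
  by (cases t) auto

lemma fst_scan_step: "fst (scan_step t) < 9"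
  by (cases t) auto

lemma transducer_wf_so_transducer: "\<exists>K. transducer_wf 9 K so_transducer"
proof -
  \<comment> \<open>Modes and tape symbols are finite in number, so the longest output word provides
    \<open>K\<close>.\<close>
  let ?L = "(\<lambda>(q, s). length (snd (snd (so_transducer q s)))) ` ({..<9} \<times> UNIV)"
  have "finite ?L" by (intro finite_imageI finite_cartesian_product) auto
  then have "length (snd (snd (so_transducer q s))) \<le> Max ?L" if "q < 9" for q s
    using that by (intro Max_ge) auto
  moreover have "fst (so_transducer q s) < 9" if "q < 9" for q s
    using that fst_matrix_step fst_scan_step by (auto simp: so_transducer_def split: option.splits)
  moreover have "so_transducer 1 s = (1, MStay, [])" for s
    by (auto simp: so_transducer_def split: option.splits)
  ultimately have "transducer_wf 9 (Max ?L) so_transducer"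
    by (simp add: transducer_wf_def)
  then show ?thesis ..
qed

section \<open>Verification of the transducer along the grammar\<close>

abbreviation so_transduces :: "nat \<Rightarrow> token list \<Rightarrow> nat \<Rightarrow> token list \<Rightarrow> bool" where
  "so_transduces \<equiv> transduces so_transducer"

lemma concat_replicate_single: "concat (replicate k [t]) = replicate k t"
  by (induction k) auto

lemma transduces_unary:
  assumes "\<delta> q (Some TTick) = (q, MRight, u)" "\<delta> q (Some TEnd) = (q', MRight, u')"
  shows "transduces \<delta> q (enc_unary k) q' (concat (replicate k u) @ u')"
proof -
  have "transduces \<delta> q (replicate k TTick) q (concat (replicate k u))"
    using transduces_map_loop[of "replicate k TTick" \<delta> q "\<lambda>_. u"] assms(1)
    by (simp add: map_replicate_const)
  moreover have "transduces \<delta> q [TEnd] q' u'" using assms(2) by (rule transduces_single)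
  ultimately show ?thesis unfolding enc_unary_def by (rule transduces_append)
qed

lemma so_transduces_var: "so_transduces 4 (enc_var j) 4 (enc_spec (bit_spec j))"
proof -
  have "so_transduces 5 (enc_unary j) 4 (concat (replicate j [TBit False]) @ [TBit True, TEnd])"
    by (rule transduces_unary) (simp_all add: so_transducer_def)
  then have "so_transduces 4 (TVar # enc_unary j) 4
      (bit_prefix @ concat (replicate j [TBit False]) @ [TBit True, TEnd])"
    by (rule transduces_Cons[rotated]) (simp add: so_transducer_def)
  then show ?thesis
    by (simp add: enc_var_def enc_unary_def bit_spec_def bit_prefix_def enc_bits_power
        enc_bits_zero concat_replicate_single)
qed

lemma so_transduces_arg:
  "so_transduces 7 (enc_var j) 7 (TBin OAdd # enc_spec (bit_spec j) @ twice_prefix)"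
proof -
  have "so_transduces 8 (enc_unary j) 7
      (concat (replicate j [TBit False]) @ [TBit True, TEnd] @ twice_prefix)"
    by (rule transduces_unary) (simp_all add: so_transducer_def)
  then have "so_transduces 7 (TVar # enc_unary j) 7
      ((TBin OAdd # bit_prefix) @ concat (replicate j [TBit False]) @ [TBit True, TEnd] @ twice_prefix)"
    by (rule transduces_Cons[rotated]) (simp add: so_transducer_def)
  then show ?thesis
    by (simp add: enc_var_def enc_unary_def bit_spec_def bit_prefix_def enc_bits_power
        enc_bits_zero concat_replicate_single)
qed

text \<open>The token closing the atom yields the constant 0 that ends Horner's scheme and also the
  end marker of the argument list of \<open>SExec\<close>.\<close>

lemma so_transduces_args:
  "so_transduces 7 (concat (map enc_var js) @ [TEnd]) 4 (enc_spec (args_spec js) @ [TEnd])"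
proof (induction js)
  case Nil
  have "so_transduces 7 [TEnd] 4 [TConst, TEnd, TEnd]"
    by (intro transduces_single) (simp add: so_transducer_def)
  then show ?case by (simp add: enc_bits_zero)
next
  case (Cons j js)
  from transduces_append[OF so_transduces_arg[of j] this] show ?case
    by (simp add: twice_prefix_def enc_bits_small)
qed

lemma so_transduces_query:
  "so_transduces 6 (enc_unary i @ concat (map enc_var js) @ [TEnd]) 4 (enc_spec (query_spec i js) @ [TEnd])"
proof (induction i)
  case 0
  have "so_transduces 6 (TEnd # concat (map enc_var js) @ [TEnd]) 4
      (twice_prefix @ enc_spec (args_spec js) @ [TEnd])"
    by (rule transduces_Cons[OF _ so_transduces_args]) (simp add: so_transducer_def)
  then show ?case by (simp add: enc_unary_def twice_prefix_def enc_bits_small)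
next
  case (Suc i)
  have "so_transduces 6 (TTick # enc_unary i @ concat (map enc_var js) @ [TEnd]) 4
      (([TBin OAdd, TConst, TBit True, TEnd] @ twice_prefix) @ enc_spec (query_spec i js) @ [TEnd])"
    by (rule transduces_Cons[OF _ Suc]) (simp add: so_transducer_def)
  then show ?case by (simp add: enc_unary_def twice_prefix_def enc_bits_small)
qed

text \<open>Both notations are prefix, so each connective is translated on the spot and mode 4 is
  resumed after every subformula, without any stack.\<close>

lemma so_transduces_form: "so_transduces 4 (enc_form f) 4 (enc_spec (form_spec f))"
proof (induction f)
  case (FVar j)
  then show ?case using so_transduces_var by simp
next
  case (FRel i js)
  have "so_transduces 4 (TRel # enc_unary i @ concat (map enc_var js) @ [TEnd]) 4
      ([TBin OLt, TConst, TEnd, TExec, TConst, TBit True, TEnd, TConst, TEnd] @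
       enc_spec (query_spec i js) @ [TEnd])"
    by (rule transduces_Cons[OF _ so_transduces_query]) (simp add: so_transducer_def)
  then show ?case by (simp add: enc_bits_small enc_bits_zero)
next
  case FTrue
  have "so_transduces 4 [TTrue] 4 [TConst, TBit True, TEnd]"
    by (intro transduces_single) (simp add: so_transducer_def)
  then show ?case by (simp add: enc_bits_small)
next
  case FFalse
  have "so_transduces 4 [TFalse] 4 [TConst, TEnd]"
    by (intro transduces_single) (simp add: so_transducer_def)
  then show ?case by (simp add: enc_bits_zero)
next
  case (FNot f)
  have "so_transduces 4 (TNot # enc_form f) 4 ([TBin OEq, TConst, TEnd] @ enc_spec (form_spec f))"
    by (rule transduces_Cons[OF _ FNot]) (simp add: so_transducer_def)
  then show ?case by (simp add: enc_bits_zero)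
next
  case (FAnd f g)
  have "so_transduces 4 (TAnd # enc_form f @ enc_form g) 4
      ([TBin OAnd] @ enc_spec (form_spec f) @ enc_spec (form_spec g))"
    by (rule transduces_Cons[OF _ transduces_append[OF FAnd]]) (simp add: so_transducer_def)
  then show ?case by simp
next
  case (FOr f g)
  have "so_transduces 4 (TOr # enc_form f @ enc_form g) 4
      ([TBin OOr] @ enc_spec (form_spec f) @ enc_spec (form_spec g))"
    by (rule transduces_Cons[OF _ transduces_append[OF FOr]]) (simp add: so_transducer_def)
  then show ?case by simp
next
  case (FImp f g)
  have "so_transduces 4 (TImp # enc_form f @ enc_form g) 4
      ([TBin OLe] @ enc_spec (form_spec f) @ enc_spec (form_spec g))"
    by (rule transduces_Cons[OF _ transduces_append[OF FImp]]) (simp add: so_transducer_def)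
  then show ?case by simp
next
  case (FIff f g)
  have "so_transduces 4 (TIff # enc_form f @ enc_form g) 4
      ([TBin OEq] @ enc_spec (form_spec f) @ enc_spec (form_spec g))"
    by (rule transduces_Cons[OF _ transduces_append[OF FIff]]) (simp add: so_transducer_def)
  then show ?case by simp
qed

lemma so_transduces_decls:
  "so_transduces 3 (concat (map (\<lambda>a. TDecl # enc_unary a) as)) 3 []"
proof (induction as)
  case Nil
  then show ?case by (simp add: transduces_Nil)
next
  case (Cons a as)
  have "so_transduces 3 (enc_unary a) 3 (concat (replicate a []) @ [])"
    by (rule transduces_unary) (simp_all add: so_transducer_def)
  moreover have "concat (replicate a []) = ([] :: token list)" by (induction a) auto
  ultimately have "so_transduces 3 (enc_unary a) 3 []" by simp
  from transduces_append[OF this Cons]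
  have "so_transduces 3 (TDecl # enc_unary a @ concat (map (\<lambda>a. TDecl # enc_unary a) as)) 3 ([] @ [] @ [])"
    by (rule transduces_Cons[rotated]) (simp add: so_transducer_def)
  then show ?case by simp
qed

lemma so_transduces_prefix:
  "so_transduces 3 (map TQuant qs) 3 (map (\<lambda>q. TBit (q = QEx)) qs)"
proof (induction qs)
  case Nil
  then show ?case by (simp add: transduces_Nil)
next
  case (Cons q qs)
  have "so_transduces 3 (TQuant q # map TQuant qs) 3 ([TBit (q = QEx)] @ map (\<lambda>q. TBit (q = QEx)) qs)"
    by (rule transduces_Cons[OF _ Cons]) (simp add: so_transducer_def)
  then show ?case by simp
qed

lemma so_transducer_form_start:
  "so_transducer 3 (Some (hd (enc_form f))) = (4, MStay, spec_middle)"
  by (cases f) (auto simp: so_transducer_def enc_var_def)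

text \<open>The pass ends on cell -1, the blank left of the input, which triggers the next
  mode.\<close>

lemma transducer_rewind:
  assumes "\<And>t. \<delta> q (Some t) = (q, MLeft, [])" "k \<le> length w"
  shows "(transducer_step \<delta> w ^^ k) (q, int k - 1, out) = (q, - 1, out)"
  using assms(2)
proof (induction k)
  case (Suc k)
  then have "tape_contents w (int k) = Some (w ! k)" by (simp add: tape_contents_def)
  then have "transducer_step \<delta> w (q, int (Suc k) - 1, out) = (q, int k - 1, out)"
    using assms(1) by (simp add: move_pos_def)
  then show ?case using Suc by (simp only: funpow_Suc_right comp_apply)
qed simp

lemma enc_fs_so_synthesis:
  "enc_fs (so_synthesis \<phi>) = replicate (length (enc_so \<phi>)) TTick @ spec_header @
     map (\<lambda>q. TBit (q = QEx)) (so_prefix \<phi>) @ spec_middle @ enc_spec (form_spec (so_matrix \<phi>))"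
  by (simp add: enc_fs_def so_synthesis_def so_spec_def spec_header_def spec_middle_def
      enc_bits_ex_mask enc_unary_def[of "Suc _"] replicate_app_Cons_same)

text \<open>Three passes of \<open>length ts\<close> steps each run forward, back and forward again.
  The four further steps turn at the right end, leave the left blank, stay put at the start of the
  matrix, and halt.\<close>

lemma so_transducer_run:
  fixes \<phi> :: so_sentence
  defines "ts \<equiv> enc_so \<phi>"
  shows "\<exists>i. (transducer_step so_transducer ts ^^ (3 * length ts + 4)) (0, 0, []) =
    (1, i, enc_fs (so_synthesis \<phi>))"
proof -
  let ?f = "transducer_step so_transducer ts" and ?n = "length ts"
  define pre where "pre = concat (map (\<lambda>a. TDecl # enc_unary a) (so_arities \<phi>)) @
     map TQuant (so_prefix \<phi>)"
  define F where "F = enc_form (so_matrix \<phi>)"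
  have ts: "ts = pre @ F" by (simp add: ts_def enc_so_def pre_def F_def)
  define o1 where "o1 = replicate ?n TTick"
  define o2 where "o2 = o1 @ spec_header"
  define o3 where "o3 = o2 @ map (\<lambda>q. TBit (q = QEx)) (so_prefix \<phi>)"
  define o4 where "o4 = o3 @ spec_middle"
  define o5 where "o5 = o4 @ enc_spec (form_spec (so_matrix \<phi>))"
  have end_blank: "tape_contents ts (int ?n) = None" by (simp add: tape_contents_def)
  have "so_transduces 0 ts 0 (concat (map (\<lambda>_. [TTick]) ts))"
    by (intro transduces_map_loop) (simp add: so_transducer_def)
  from transducesD[OF this, of "[]" "[]" "[]"] have 1: "(?f ^^ ?n) (0, 0, []) = (0, int ?n, o1)"
    by (simp add: o1_def map_replicate_const concat_replicate_single)
  have 2: "?f (0, int ?n, o1) = (2, int ?n - 1, o2)"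
    using end_blank by (simp add: so_transducer_def move_pos_def o2_def)
  have 3: "(?f ^^ ?n) (2, int ?n - 1, o2) = (2, - 1, o2)"
    by (rule transducer_rewind) (simp_all add: so_transducer_def)
  have 4: "?f (2, - 1, o2) = (3, 0, o2)"
    by (simp add: so_transducer_def tape_contents_def move_pos_def)
  have "so_transduces 3 pre 3 ([] @ map (\<lambda>q. TBit (q = QEx)) (so_prefix \<phi>))"
    unfolding pre_def by (rule transduces_append[OF so_transduces_decls so_transduces_prefix])
  from transducesD[OF this, of "[]" F o2] have 5: "(?f ^^ length pre) (3, 0, o2) = (3, int (length pre), o3)"
    by (simp add: ts o3_def)
  have "F \<noteq> []" using length_enc_form_pos by (auto simp: F_def)
  then have "tape_contents ts (int (length pre)) = Some (hd F)"
    unfolding ts by (cases F) (simp_all add: tape_contents_middle)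
  then have 6: "?f (3, int (length pre), o3) = (4, int (length pre), o4)"
    using so_transducer_form_start[of "so_matrix \<phi>"] by (simp add: F_def[symmetric] move_pos_def o4_def)
  from transducesD[OF so_transduces_form[of "so_matrix \<phi>"], of pre "[]" o4]
  have 7: "(?f ^^ length F) (4, int (length pre), o4) = (4, int ?n, o5)"
    by (simp add: ts o5_def F_def)
  have 8: "?f (4, int ?n, o5) = (1, int ?n, o5)"
    using end_blank by (simp add: so_transducer_def move_pos_def)
  have n: "3 * ?n + 4 = Suc (length F + Suc (length pre + Suc (?n + Suc ?n)))"
    by (simp add: ts)
  have "(?f ^^ (3 * ?n + 4)) (0, 0, []) = (1, int ?n, o5)"
    unfolding n by (simp only: funpow.simps funpow_add comp_apply 1 2 3 4 5 6 7 8)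
  moreover have "o5 = enc_fs (so_synthesis \<phi>)"
    by (simp add: enc_fs_so_synthesis o5_def o4_def o3_def o2_def o1_def ts_def)
  ultimately show ?thesis by blast
qed

lemma poly_time_computable_so_synthesis:
  "poly_time_computable SO_SAT Finite_Synthesis so_synthesis"
proof -
  obtain K where K: "transducer_wf 9 K so_transducer" using transducer_wf_so_transducer by blast
  \<comment> \<open>Each of the \<open>3 * n + 4\<close> transducer steps costs at most
    \<open>K + 1\<close> machine steps; the constant coefficient comes first.\<close>
  let ?p = "[:4 * (K + 1), 3 * (K + 1):]"
  have "tm_outputs_within (transducer_tm 9 K so_transducer) (enc_so \<phi>) (poly ?p (length (enc_so \<phi>)))
      (enc_fs (so_synthesis \<phi>))" for \<phi>
  proof -
    obtain i where "(transducer_step so_transducer (enc_so \<phi>) ^^ (3 * length (enc_so \<phi>) + 4)) (0, 0, []) =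
      (1, i, enc_fs (so_synthesis \<phi>))" using so_transducer_run by blast
    then show ?thesis by (rule transducer_tm_outputs[OF K]) (simp add: algebra_simps)
  qed
  then show ?thesis using tm_wf_transducer_tm[OF K]
    unfolding poly_time_computable_def SO_SAT_def Finite_Synthesis_def by (auto simp del: poly_pCons)
qed

theorem theorem5: "poly_time_reducible SO_SAT Finite_Synthesis"
  unfolding poly_time_reducible_def
proof (intro exI[of _ so_synthesis] conjI ballI)
  show "poly_time_computable SO_SAT Finite_Synthesis so_synthesis"
    by (rule poly_time_computable_so_synthesis)
next
  fix \<phi> assume "\<phi> \<in> instances SO_SAT"
  then have "so_wf \<phi>" by (simp add: SO_SAT_def)
  then show "holds SO_SAT \<phi> \<longleftrightarrow> holds Finite_Synthesis (so_synthesis \<phi>)"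
    using fs_true_so_synthesis_if so_true_if_fs_true_so_synthesis
    by (auto simp: SO_SAT_def Finite_Synthesis_def)
  show "so_synthesis \<phi> \<in> instances Finite_Synthesis"
    using fs_wf_so_synthesis by (simp add: Finite_Synthesis_def)
qed

end
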